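(* Let $R$ be an integral domain, let $G,H$ be discrete groups that are indicable throughout, let $X,Y$ be totally disconnected, locally compact, Hausdorff spaces, and let $\theta=(\{X_g\}_{g\in G},\{\theta_g\}_{g\in G})$ and $\gamma=(\{Y_h\}_{h\in H},\{\gamma_h\}_{h\in H})$ be partial actions of $G$ on $X$ and of $H$ on $Y$, with all $X_g$ and all $Y_h$ clopen. Then the following are equivalent: (i) the transformation groupoids $G\ltimes_\theta X$ and $H\ltimes_\gamma Y$ are isomorphic as topological groupoids; (ii) there exists a diagonal-preserving isomorphism $\Gamma: A_R(G\ltimes_\theta X)\to A_R(H\ltimes_\gamma Y)$; (iii) there exists an isomorphism $\Phi:\mathcal{L}_c(X)\rtimes G\to\mathcal{L}_c(Y)\rtimes H$ with $\Phi(\mathcal{L}_c(X))=\mathcal{L}_c(Y)$.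
   Context: An integral domain is a commutative ring with unit and no zero-divisors. Isomorphisms in (ii) and (iii) are isomorphisms of $R$-algebras. Partial action: a (topological) partial action of a discrete group $G$ on a space $X$ is a family of open subsets $X_g\subseteq X$ and homeomorphisms $\theta_g: X_{g^{-1}}\to X_g$ ($g\in G$) with $X_1=X$, $\theta_1=\mathrm{id}_X$, $\theta_g^{-1}=\theta_{g^{-1}}$, $\theta_g(X_{g^{-1}}\cap X_h)\subseteq X_g\cap X_{gh}$, and $\theta_g(\theta_h(x))=\theta_{gh}(x)$ for all $x\in X_{h^{-1}}\cap X_{h^{-1}g^{-1}}$. Indicable throughout: an infinite group $G$ is said to be indexed if a homomorphism from $G$ to the additive group of integers is given whose image is not $\{0\}$. An infinite group is indicable throughout if every subgroup not consisting of the unit alone can be indexed (i.e. admits a nonzero homomorphism to $\mathbb{Z}$). $\mathcal{L}_c(X)$: the commutative $R$-algebra (pointwise operations) of locally constant functions $f:X\to R$ with compact support, where $\mathrm{supp}(f)=\{x: f(x)\neq 0\}$. Partial skew group ring: put $D_g=\{f\in\mathcal{L}_c(X): f \text{ vanishes on } X\setminus X_g\}$ and let $\alpha_g:D_{g^{-1}}\to D_g$ be $\alpha_g(f)=f\circ\theta_{g^{-1}}$ on $X_g$, extended by $0$. $\mathcal{L}_c(X)\rtimes G$ is the set of finite formal sums $\sum_{g\in G} f_g\delta_g$ with $f_g\in D_g$, with componentwise addition and $R$-action, and product the linear extension of $(f_g\delta_g)(f_h\delta_h)=\alpha_g(\alpha_{g^{-1}}(f_g)f_h)\delta_{gh}$.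 $\mathcal{L}_c(X)$ is identified with the subalgebra $\mathcal{L}_c(X)\delta_1$. Analogously for $\mathcal{L}_c(Y)\rtimes H$. Transformation groupoid: $G\ltimes_\theta X=\{(t,x): t\in G,\ x\in X_t\}$ with the topology inherited from $G\times X$; $(t,x)^{-1}=(t^{-1},\theta_{t^{-1}}(x))$; $(s,y),(t,x)$ are composable iff $\theta_{s^{-1}}(y)=x$, and then $(s,y)(t,x)=(st,y)$. It is a Hausdorff ample groupoid with unit space $\{1\}\times X$. An isomorphism of topological groupoids is a homeomorphism carrying units to units, preserving range and source maps, and multiplicative on composable pairs. Steinberg algebra and diagonal: for a Hausdorff ample groupoid $\mathcal{G}$ with unit space $\mathcal{G}^{(0)}$, $A_R(\mathcal{G})$ is the $R$-algebra of locally constant, compactly supported functions $\mathcal{G}\to R$, with pointwise addition and convolution $(f*g)(b)=\sum_{cd=b}f(c)g(d)$. The diagonal is $D_R(\mathcal{G})=\{f\in A_R(\mathcal{G}):\mathrm{supp}(f)\subseteq\mathcal{G}^{(0)}\}$. An isomorphism $\phi:A_R(\mathcal{G}_1)\to A_R(\mathcal{G}_2)$ is diagonal-preserving if $\phi(D_R(\mathcal{G}_1))=D_R(\mathcal{G}_2)$. *)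

theory Defs
  imports "HOL-Analysis.Analysis" "HOL-Algebra.Elementary_Groups"
begin

section \<open>Spaces and locally constant functions\<close>

definition totally_disconnected_space :: "'a topology \<Rightarrow> bool"
  where "totally_disconnected_space X \<longleftrightarrow>
    (\<forall>S. connectedin X S \<longrightarrow> (\<exists>a. S \<subseteq> {a}))"

definition locally_constant_on_space :: "'a topology \<Rightarrow> ('a \<Rightarrow> 'b) \<Rightarrow> bool"
  where "locally_constant_on_space X f \<longleftrightarrow>
    (\<forall>x\<in>topspace X. \<exists>U. openin X U \<and> x \<in> U \<and> (\<forall>y\<in>U. f y = f x))"

definition supp :: "('a \<Rightarrow> 'r::zero) \<Rightarrow> 'a set"
  where "supp f = {x. f x \<noteq> 0}"

text \<open>A function on \<open>X\<close> is represented by its extension by \<open>0\<close> to the ambient type; the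
  condition \<open>compactin X (supp f)\<close> contains \<open>supp f \<subseteq> topspace X\<close>.\<close>

definition Lc :: "'a topology \<Rightarrow> ('a \<Rightarrow> 'r::zero) set"
  where "Lc X = {f. locally_constant_on_space X f \<and> compactin X (supp f)}"


section \<open>Algebras, not necessarily unital, over a commutative ring\<close>

record ('r, 'a) ralgebra =
  alg_carrier :: "'a set"
  alg_add :: "'a \<Rightarrow> 'a \<Rightarrow> 'a"
  alg_mult :: "'a \<Rightarrow> 'a \<Rightarrow> 'a"
  alg_scale :: "'r \<Rightarrow> 'a \<Rightarrow> 'a"

definition algebra_iso :: "('r, 'a) ralgebra \<Rightarrow> ('r, 'b) ralgebra \<Rightarrow> ('a \<Rightarrow> 'b) \<Rightarrow> bool"
  where "algebra_iso A B \<phi> \<longleftrightarrow>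
    bij_betw \<phi> (alg_carrier A) (alg_carrier B) \<and>
    (\<forall>a\<in>alg_carrier A. \<forall>b\<in>alg_carrier A. \<phi> (alg_add A a b) = alg_add B (\<phi> a) (\<phi> b)) \<and>
    (\<forall>a\<in>alg_carrier A. \<forall>b\<in>alg_carrier A. \<phi> (alg_mult A a b) = alg_mult B (\<phi> a) (\<phi> b)) \<and>
    (\<forall>r. \<forall>a\<in>alg_carrier A. \<phi> (alg_scale A r a) = alg_scale B r (\<phi> a))"


section \<open>Groups that are indicable throughout\<close>

definition can_be_indexed :: "('g, 'k) monoid_scheme \<Rightarrow> bool"
  where "can_be_indexed G \<longleftrightarrow>
    infinite (carrier G) \<and> (\<exists>\<phi>\<in>hom G integer_group. \<phi> ` carrier G \<noteq> {0})"

definition indicable_throughout :: "('g, 'k) monoid_scheme \<Rightarrow> bool"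
  where "indicable_throughout G \<longleftrightarrow>
    infinite (carrier G) \<and>
    (\<forall>K. subgroup K G \<and> K \<noteq> {\<one>\<^bsub>G\<^esub>} \<longrightarrow> can_be_indexed (G\<lparr>carrier := K\<rparr>))"


section \<open>Partial actions\<close>

text \<open>\<open>D g\<close> is the open set \<open>X\<^sub>g\<close>; the values of \<open>\<theta> g\<close> matter only on \<open>D (inv g)\<close>.\<close>

locale partial_action = group G
  for G :: "('g, 'k) monoid_scheme" (structure) +
  fixes X :: "'x topology"
    and D :: "'g \<Rightarrow> 'x set"
    and \<theta> :: "'g \<Rightarrow> 'x \<Rightarrow> 'x"
  assumes open_dom: "g \<in> carrier G \<Longrightarrow> openin X (D g)"
    and homeo: "g \<in> carrier G \<Longrightarrow>
      homeomorphic_maps (subtopology X (D (inv g))) (subtopology X (D g)) (\<theta> g) (\<theta> (inv g))"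
    and dom_one: "D \<one> = topspace X"
    and act_one: "x \<in> topspace X \<Longrightarrow> \<theta> \<one> x = x"
    and act_image: "g \<in> carrier G \<Longrightarrow> h \<in> carrier G \<Longrightarrow>
      \<theta> g ` (D (inv g) \<inter> D h) \<subseteq> D g \<inter> D (g \<otimes> h)"
    and act_act: "g \<in> carrier G \<Longrightarrow> h \<in> carrier G \<Longrightarrow> x \<in> D (inv h) \<inter> D (inv h \<otimes> inv g) \<Longrightarrow>
      \<theta> g (\<theta> h x) = \<theta> (g \<otimes> h) x"


section \<open>The partial skew group ring\<close>

definition skew_ideal :: "'x topology \<Rightarrow> ('g \<Rightarrow> 'x set) \<Rightarrow> 'g \<Rightarrow> ('x \<Rightarrow> 'r::zero) set"
  where "skew_ideal X D g = {f \<in> Lc X. \<forall>x \<in> topspace X - D g. f x = 0}"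

definition skew_alpha ::
    "('g, 'k) monoid_scheme \<Rightarrow> ('g \<Rightarrow> 'x set) \<Rightarrow> ('g \<Rightarrow> 'x \<Rightarrow> 'x) \<Rightarrow>
     'g \<Rightarrow> ('x \<Rightarrow> 'r::zero) \<Rightarrow> 'x \<Rightarrow> 'r"
  where "skew_alpha G D \<theta> g f = (\<lambda>x. if x \<in> D g then f (\<theta> (inv\<^bsub>G\<^esub> g) x) else 0)"

text \<open>The formal sum of the \<open>F g \<delta>\<^sub>g\<close> is represented by its coefficient family \<open>F\<close>, and
  \<open>skew_delta g f\<close> is the monomial \<open>f \<delta>\<^sub>g\<close>.\<close>

definition skew_delta :: "'g \<Rightarrow> ('x \<Rightarrow> 'r::zero) \<Rightarrow> 'g \<Rightarrow> 'x \<Rightarrow> 'r"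
  where "skew_delta g f = (\<lambda>k x. if k = g then f x else 0)"

definition skew_supp :: "('g \<Rightarrow> 'x \<Rightarrow> 'r::zero) \<Rightarrow> 'g set"
  where "skew_supp F = {g. F g \<noteq> (\<lambda>x. 0)}"

definition skew_mult ::
    "('g, 'k) monoid_scheme \<Rightarrow> ('g \<Rightarrow> 'x set) \<Rightarrow> ('g \<Rightarrow> 'x \<Rightarrow> 'x) \<Rightarrow>
     ('g \<Rightarrow> 'x \<Rightarrow> 'r::comm_ring_1) \<Rightarrow> ('g \<Rightarrow> 'x \<Rightarrow> 'r) \<Rightarrow> 'g \<Rightarrow> 'x \<Rightarrow> 'r"
  where "skew_mult G D \<theta> F K = (\<lambda>k x. \<Sum>g\<in>skew_supp F. \<Sum>h\<in>skew_supp K.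
    skew_delta (g \<otimes>\<^bsub>G\<^esub> h)
      (skew_alpha G D \<theta> g (\<lambda>y. skew_alpha G D \<theta> (inv\<^bsub>G\<^esub> g) (F g) y * K h y)) k x)"

definition skew_ring ::
    "('g, 'k) monoid_scheme \<Rightarrow> 'x topology \<Rightarrow> ('g \<Rightarrow> 'x set) \<Rightarrow> ('g \<Rightarrow> 'x \<Rightarrow> 'x) \<Rightarrow>
     ('r::comm_ring_1, 'g \<Rightarrow> 'x \<Rightarrow> 'r) ralgebra"
  where "skew_ring G X D \<theta> = \<lparr>
    alg_carrier = {F. finite (skew_supp F) \<and> skew_supp F \<subseteq> carrier G \<and>
                      (\<forall>g\<in>carrier G. F g \<in> skew_ideal X D g)},
    alg_add = (\<lambda>F K g x. F g x + K g x),
    alg_mult = skew_mult G D \<theta>,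
    alg_scale = (\<lambda>r F g x. r * F g x)\<rparr>"

definition Lc_in_skew :: "('g, 'k) monoid_scheme \<Rightarrow> 'x topology \<Rightarrow> ('g \<Rightarrow> 'x \<Rightarrow> 'r::zero) set"
  where "Lc_in_skew G X = skew_delta \<one>\<^bsub>G\<^esub> ` Lc X"


section \<open>Topological groupoids\<close>

record 'm top_groupoid =
  arrows :: "'m topology"
  composable :: "'m \<Rightarrow> 'm \<Rightarrow> bool"
  gmult :: "'m \<Rightarrow> 'm \<Rightarrow> 'm"
  ginv :: "'m \<Rightarrow> 'm"

definition gsource :: "'m top_groupoid \<Rightarrow> 'm \<Rightarrow> 'm"
  where "gsource \<G> a = gmult \<G> (ginv \<G> a) a"

definition grange :: "'m top_groupoid \<Rightarrow> 'm \<Rightarrow> 'm"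
  where "grange \<G> a = gmult \<G> a (ginv \<G> a)"

definition gunits :: "'m top_groupoid \<Rightarrow> 'm set"
  where "gunits \<G> = gsource \<G> ` topspace (arrows \<G>)"

definition top_groupoid_iso ::
    "'m top_groupoid \<Rightarrow> 'n top_groupoid \<Rightarrow> ('m \<Rightarrow> 'n) \<Rightarrow> bool"
  where "top_groupoid_iso \<G> \<H> \<phi> \<longleftrightarrow>
    homeomorphic_map (arrows \<G>) (arrows \<H>) \<phi> \<and>
    \<phi> ` gunits \<G> \<subseteq> gunits \<H> \<and>
    (\<forall>a\<in>topspace (arrows \<G>). grange \<H> (\<phi> a) = \<phi> (grange \<G> a) \<and>
                                 gsource \<H> (\<phi> a) = \<phi> (gsource \<G> a)) \<and>
    (\<forall>a b. composable \<G> a b \<longrightarrow> \<phi> (gmult \<G> a b) = gmult \<H> (\<phi> a) (\<phi> b))"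

definition transformation_groupoid ::
    "('g, 'k) monoid_scheme \<Rightarrow> 'x topology \<Rightarrow> ('g \<Rightarrow> 'x set) \<Rightarrow> ('g \<Rightarrow> 'x \<Rightarrow> 'x) \<Rightarrow>
     ('g \<times> 'x) top_groupoid"
  where "transformation_groupoid G X D \<theta> = \<lparr>
    arrows = subtopology (prod_topology (discrete_topology (carrier G)) X)
               {(t, x). t \<in> carrier G \<and> x \<in> D t},
    composable = (\<lambda>(s, y) (t, x). s \<in> carrier G \<and> y \<in> D s \<and> t \<in> carrier G \<and> x \<in> D t \<and>
                                  \<theta> (inv\<^bsub>G\<^esub> s) y = x),
    gmult = (\<lambda>(s, y) (t, x). (s \<otimes>\<^bsub>G\<^esub> t, y)),
    ginv = (\<lambda>(t, x). (inv\<^bsub>G\<^esub> t, \<theta> (inv\<^bsub>G\<^esub> t) x))\<rparr>"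


section \<open>Steinberg algebras\<close>

text \<open>\<open>sum\<close> is \<open>0\<close> on infinite index sets, so the convolution sum is taken over the pairs whose
  term can be nonzero; for compactly supported functions on a Hausdorff ample groupoid these are
  finitely many.\<close>

definition convolution ::
    "'m top_groupoid \<Rightarrow> ('m \<Rightarrow> 'r::comm_ring_1) \<Rightarrow> ('m \<Rightarrow> 'r) \<Rightarrow> 'm \<Rightarrow> 'r"
  where "convolution \<G> f g = (\<lambda>b.
    \<Sum>(c, d) | composable \<G> c d \<and> gmult \<G> c d = b \<and> f c \<noteq> 0 \<and> g d \<noteq> 0. f c * g d)"

definition steinberg_algebra :: "'m top_groupoid \<Rightarrow> ('r::comm_ring_1, 'm \<Rightarrow> 'r) ralgebra"
  where "steinberg_algebra \<G> = \<lparr>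
    alg_carrier = Lc (arrows \<G>),
    alg_add = (\<lambda>f g a. f a + g a),
    alg_mult = convolution \<G>,
    alg_scale = (\<lambda>r f a. r * f a)\<rparr>"

definition steinberg_diagonal :: "'m top_groupoid \<Rightarrow> ('m \<Rightarrow> 'r::comm_ring_1) set"
  where "steinberg_diagonal \<G> = {f \<in> alg_carrier (steinberg_algebra \<G>). supp f \<subseteq> gunits \<G>}"

definition diagonal_preserving_iso ::
    "'m top_groupoid \<Rightarrow> 'n top_groupoid \<Rightarrow> (('m \<Rightarrow> 'r::comm_ring_1) \<Rightarrow> ('n \<Rightarrow> 'r)) \<Rightarrow> bool"
  where "diagonal_preserving_iso \<G> \<H> \<phi> \<longleftrightarrow>
    algebra_iso (steinberg_algebra \<G>) (steinberg_algebra \<H>) \<phi> \<and>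
    \<phi> ` steinberg_diagonal \<G> = steinberg_diagonal \<H>"


section \<open>The derived operations in the intended case\<close>

lemma skew_alpha_zero [simp]: "skew_alpha G D \<theta> g (\<lambda>x. 0) = (\<lambda>x. 0)"
  by (simp add: skew_alpha_def fun_eq_iff)

lemma skew_mult_delta:
  fixes f f' :: "'x \<Rightarrow> 'r::comm_ring_1"
  shows "skew_mult G D \<theta> (skew_delta g f) (skew_delta h f') =
    skew_delta (g \<otimes>\<^bsub>G\<^esub> h)
      (skew_alpha G D \<theta> g (\<lambda>y. skew_alpha G D \<theta> (inv\<^bsub>G\<^esub> g) f y * f' y))"
proof -
  have supp: "skew_supp (skew_delta a u) = (if u = (\<lambda>x. 0) then {} else {a})"
    for a and u :: "'x \<Rightarrow> 'r"
    by (auto simp: skew_supp_def skew_delta_def fun_eq_iff)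
  have diag: "skew_delta a u a = u" for a and u :: "'x \<Rightarrow> 'r"
    by (simp add: skew_delta_def)
  have null: "skew_delta a (\<lambda>x. 0) = (\<lambda>k x. 0 :: 'r)" for a
    by (simp add: skew_delta_def fun_eq_iff)
  show ?thesis
    by (cases "f = (\<lambda>x. 0)"; cases "f' = (\<lambda>x. 0)")
      (simp_all add: skew_mult_def supp diag null)
qed

context partial_action
begin

abbreviation "\<G> \<equiv> transformation_groupoid G X D \<theta>"

lemma dom_subset: "g \<in> carrier G \<Longrightarrow> D g \<subseteq> topspace X"
  by (simp add: open_dom openin_subset)

lemma arrows_transformation: "topspace (arrows \<G>) = {(t, x). t \<in> carrier G \<and> x \<in> D t}"
  using dom_subset by (auto simp: transformation_groupoid_def)

lemma source_transformation:
  "t \<in> carrier G \<Longrightarrow> gsource \<G> (t, x) = (\<one>, \<theta> (inv t) x)"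
  by (simp add: transformation_groupoid_def gsource_def)

lemma range_transformation: "t \<in> carrier G \<Longrightarrow> grange \<G> (t, x) = (\<one>, x)"
  by (simp add: transformation_groupoid_def grange_def)

lemma act_inv_in:
  assumes "t \<in> carrier G" "x \<in> D t" shows "\<theta> (inv t) x \<in> D (inv t)"
  using act_image[of "inv t" t] assms by auto

lemma units_transformation: "gunits \<G> = {\<one>} \<times> topspace X"
proof
  show "gunits \<G> \<subseteq> {\<one>} \<times> topspace X"
  proof
    fix a assume "a \<in> gunits \<G>"
    then obtain t x where "t \<in> carrier G" "x \<in> D t" and a: "a = gsource \<G> (t, x)"
      unfolding gunits_def arrows_transformation by blast
    then show "a \<in> {\<one>} \<times> topspace X"
      using act_inv_in[of t x] dom_subset[of "inv t"] by (auto simp: source_transformation)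
  qed
  show "{\<one>} \<times> topspace X \<subseteq> gunits \<G>"
  proof clarify
    fix x assume "x \<in> topspace X"
    then have "(\<one>, x) \<in> topspace (arrows \<G>)" "gsource \<G> (\<one>, x) = (\<one>, x)"
      by (simp_all add: arrows_transformation source_transformation dom_one act_one)
    then show "(\<one>, x) \<in> gunits \<G>"
      unfolding gunits_def by (metis imageI)
  qed
qed

lemma composable_transformation:
  "composable \<G> a b \<longleftrightarrow>
     a \<in> topspace (arrows \<G>) \<and> b \<in> topspace (arrows \<G>) \<and> gsource \<G> a = grange \<G> b"
proof -
  obtain s y t x where ab: "a = (s, y)" "b = (t, x)"
    by (cases a; cases b)
  have "composable \<G> a b \<longleftrightarrow>
      s \<in> carrier G \<and> y \<in> D s \<and> t \<in> carrier G \<and> x \<in> D t \<and> \<theta> (inv s) y = x"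
    by (simp add: ab transformation_groupoid_def)
  then show ?thesis
    by (auto simp: ab arrows_transformation source_transformation range_transformation)
qed

lemma mult_transformation_closed:
  assumes "composable \<G> a b" shows "gmult \<G> a b \<in> topspace (arrows \<G>)"
proof -
  obtain s y t x where ab: "a = (s, y)" "b = (t, x)"
    by (cases a; cases b)
  with assms have *: "s \<in> carrier G" "y \<in> D s" "t \<in> carrier G" "x \<in> D t" "\<theta> (inv s) y = x"
    by (auto simp: transformation_groupoid_def)
  have "x \<in> D (inv s)"
    using act_inv_in * by auto
  moreover have "\<theta> s x = y"
    using homeo[of s] dom_subset[of s] * by (auto simp: homeomorphic_maps_def)
  ultimately have "y \<in> D (s \<otimes> t)"
    using act_image[of s t] * by auto
  then show ?thesis
    using * by (simp add: ab arrows_transformation) (simp add: transformation_groupoid_def)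
qed

end

end

theory Submission
  imports Defs
begin

text \<open>Let \<open>n\<close> be a normalizer of the diagonal with partner \<open>n'\<close>, and fix a unit \<open>x\<close>. Sandwiching the
  indicator of a small neighbourhood of \<open>x\<close> between \<open>n\<close> and \<open>n'\<close> shows that the products of arrows of
  \<open>supp n\<close> starting at \<open>x\<close> with arrows of \<open>supp n'\<close> ending at \<open>x\<close> contribute only to units. An arrow
  is determined by its group component and its source, and a group that is indicable throughout has
  the two unique products property, so both sets of arrows are singletons: supports of normalizers
  are compact open bisections. No separate analysis of the isotropy group rings is needed.

  Inclusion of such supports can be expressed by the multiplication and the diagonal
  (\<open>supp n \<subseteq> supp m\<close> iff \<open>n m'\<close> is diagonal and \<open>n m' m = n\<close>), so a diagonal-preserving isomorphism
  \<open>\<Gamma>\<close> induces an order isomorphism \<open>B \<mapsto> supp (\<Gamma> 1\<^sub>B)\<close> between the compact open bisections of the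
  two groupoids, hence a homeomorphism of the arrow spaces. Since \<open>1\<^sub>B * 1\<^sub>C = 1\<^bsub>BC\<^esub>\<close>, it is
  multiplicative.

  Uncurrying the coefficient family identifies the partial skew group ring with the Steinberg
  algebra, and its coefficient algebra with the diagonal.\<close>

section \<open>Unique products\<close>

text \<open>Why two unique products and not one: a unique product over \<open>x\<close> is the group
  component of an arrow at which the sandwiched function is nonzero, so it must be
  \<open>\<one>\<close>. One unique product equal to \<open>\<one>\<close> would not exclude further
  arrows in the fibres; two with different values cannot both be \<open>\<one>\<close>, which leaves
  only singletons. The absence of zero divisors among the coefficients enters twice: the single
  surviving summand is nonzero, and the equation n n' n = n can be cancelled pointwise, so
  normalizers take invertible values on their supports. These values need not be \<open>1\<close>.
  Hence \<open>\<Gamma>\<close> need not send indicators to indicators, and only supports are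
  compared. For products one inclusion is enough: a nonzero value of a convolution exhibits some
  factorization, and injectivity of range and source on bisections then tells which one it is.
  Bisections are closed under intersection and difference but not under union, so arrows are
  recovered from them by a compactness argument that uses only these two operations.\<close>

definition (in monoid) unique_product :: "'a set \<Rightarrow> 'a set \<Rightarrow> 'a \<Rightarrow> 'a \<Rightarrow> bool"
  where "unique_product A B a b \<longleftrightarrow>
    a \<in> A \<and> b \<in> B \<and> (\<forall>a'\<in>A. \<forall>b'\<in>B. a' \<otimes> b' = a \<otimes> b \<longrightarrow> a' = a \<and> b' = b)"

text \<open>Induction on \<open>card A + card B\<close>. After translating so that both sets contain
  \<open>\<one>\<close>, they generate a nontrivial subgroup \<open>K\<close>, and a nonzero
  homomorphism from \<open>K\<close> to the integers grades all products. The factors of highest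
  degree form smaller sets, to which the induction hypothesis applies, and so do those of lowest
  degree. The two unique products found in this way have different degrees, hence different
  values.\<close>

lemma (in group) two_unique_products:
  assumes ind: "indicable_throughout G"
    and "finite A" "finite B" "A \<noteq> {}" "B \<noteq> {}" "A \<subseteq> carrier G" "B \<subseteq> carrier G"
  shows "(\<exists>a b. unique_product A B a b) \<and>
    ((\<exists>a b. A = {a} \<and> B = {b}) \<or>
     (\<exists>a b c d. unique_product A B a b \<and> unique_product A B c d \<and> a \<otimes> b \<noteq> c \<otimes> d))"
  using assms(2-)
proof (induction "card A + card B" arbitrary: A B rule: less_induct)
  case less
  note fin = less.prems(1,2) and sub = less.prems(5,6)
  obtain a0 b0 where a0: "a0 \<in> A" and b0: "b0 \<in> B"
    using less.prems by blast
  have a0c: "a0 \<in> carrier G" and b0c: "b0 \<in> carrier G"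
    using a0 b0 sub by auto
  show ?case
  proof (cases "A = {a0} \<and> B = {b0}")
    case True
    then have "unique_product A B a0 b0"
      by (simp add: unique_product_def)
    with True show ?thesis by blast
  next
    case False
    \<comment> \<open>Multiplying \<open>A\<close> by \<open>inv a0\<close> on the left and
      \<open>B\<close> by \<open>inv b0\<close> on the right sends \<open>a0\<close> and
      \<open>b0\<close> to \<open>\<one>\<close> and does not affect which products are unique. A
      trivial \<open>K\<close> would force \<open>A = {a0}\<close> and
      \<open>B = {b0}\<close>.\<close>
    define S where "S = (\<lambda>a. inv a0 \<otimes> a) ` A \<union> (\<lambda>b. b \<otimes> inv b0) ` B"
    have S: "S \<subseteq> carrier G"
      using sub a0c b0c by (auto simp: S_def)
    define K where "K = generate G S"
    have K: "subgroup K G"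
      unfolding K_def by (rule generate_is_subgroup[OF S])
    have SK: "S \<subseteq> K"
      unfolding K_def by (auto intro: generate.incl)
    have "K \<noteq> {\<one>}"
    proof
      assume "K = {\<one>}"
      then have eA: "inv a0 \<otimes> a = \<one>" if "a \<in> A" for a
        using SK that by (auto simp: S_def)
      have "a = a0" if "a \<in> A" for a
      proof -
        have "a \<in> carrier G"
          using sub that by auto
        then show ?thesis using eA[OF that] a0c inv_solve_left'[of \<one> a0 a] by simp
      qed
      moreover from \<open>K = {\<one>}\<close> have eB: "b \<otimes> inv b0 = \<one>" if "b \<in> B" for b
        using SK that by (auto simp: S_def)
      have "b = b0" if "b \<in> B" for b
      proof -
        have "b \<in> carrier G"
          using sub that by auto
        then show ?thesis using eB[OF that] b0c inv_solve_right'[of \<one> b b0] by simp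
      qed
      ultimately show False
        using False a0 b0 by blast
    qed
    then have "can_be_indexed (G\<lparr>carrier := K\<rparr>)"
      using ind K by (simp add: indicable_throughout_def)
    then have "\<exists>\<phi>\<in>hom (G\<lparr>carrier := K\<rparr>) integer_group. \<phi> ` K \<noteq> {0}"
      by (simp add: can_be_indexed_def)
    then obtain \<phi> where \<phi>: "\<phi> \<in> hom (G\<lparr>carrier := K\<rparr>) integer_group" "\<phi> ` K \<noteq> {0}"
      by (elim bexE)
    interpret K: group "G\<lparr>carrier := K\<rparr>"
      using K by (rule subgroup_imp_group)
    have \<phi>_mult: "\<phi> (x \<otimes> y) = \<phi> x + \<phi> y" if "x \<in> K" "y \<in> K" for x y
      using hom_mult[OF \<phi>(1)] that by simp
    have \<phi>_one: "\<phi> \<one> = 0"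
      using \<phi>_mult[of \<one> \<one>] subgroup.one_closed[OF K] by simp
    have \<phi>_inv: "\<phi> (inv x) = - \<phi> x" if "x \<in> K" for x
      using \<phi>_mult[of x "inv x"] \<phi>_one subgroup.m_inv_closed[OF K] subgroup.mem_carrier[OF K] that by simp
    have "\<exists>x\<in>S. \<phi> x \<noteq> 0"
    proof (rule ccontr)
      assume neg: "\<not> (\<exists>x\<in>S. \<phi> x \<noteq> 0)"
      have "\<phi> x = 0" if "x \<in> K" for x
        using that unfolding K_def
      proof (induction rule: generate.induct)
        case (inv h)
        then show ?case using neg \<phi>_inv[of h] SK by auto
      next
        case (eng x y)
        then show ?case using \<phi>_mult[of x y] unfolding K_def by simp
      qed (use neg \<phi>_one in auto)
      then show False
        using \<phi>(2) subgroup.one_closed[OF K] by auto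
    qed
    then obtain x where x: "x \<in> S" "\<phi> x \<noteq> 0"
      by blast
    \<comment> \<open>Degrees relative to \<open>a0\<close> and \<open>b0\<close>. The sum
      \<open>f a + g b\<close> is the value of \<open>\<phi>\<close> at
      \<open>inv a0 \<otimes> (a \<otimes> b) \<otimes> inv b0\<close>, so it depends on the product
      \<open>a \<otimes> b\<close> alone.\<close>
    define f where "f a = \<phi> (inv a0 \<otimes> a)" for a
    define g where "g b = \<phi> (b \<otimes> inv b0)" for b
    have fg0: "f a0 = 0" "g b0 = 0"
      using a0c b0c by (simp_all add: f_def g_def \<phi>_one)
    have nonconst: "(\<exists>a\<in>A. f a \<noteq> f a0) \<or> (\<exists>b\<in>B. g b \<noteq> g b0)"
      using x unfolding fg0 by (auto simp: S_def f_def g_def)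
    have fg: "f a + g b = f a' + g b'" if eq: "a' \<otimes> b' = a \<otimes> b" and in_AB: "a \<in> A" "b \<in> B" "a' \<in> A" "b' \<in> B"
      for a b a' b'
    proof -
      have "f c + g d = \<phi> (inv a0 \<otimes> (c \<otimes> d) \<otimes> inv b0)" if "c \<in> A" "d \<in> B" for c d
      proof -
        have "inv a0 \<otimes> (c \<otimes> d) \<otimes> inv b0 = (inv a0 \<otimes> c) \<otimes> (d \<otimes> inv b0)"
          using a0c b0c sub that by (simp add: m_assoc subset_iff)
        moreover have "inv a0 \<otimes> c \<in> K" "d \<otimes> inv b0 \<in> K"
          using SK that by (auto simp: S_def)
        ultimately show ?thesis
          using \<phi>_mult by (simp add: f_def g_def)
      qed
      then show ?thesis using in_AB eq by metis
    qed
    \<comment> \<open>If \<open>u + v\<close> is attained only with \<open>f a = u\<close> and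
      \<open>g b = v\<close>, every competing factorization of a product in that degree stays inside
      the two level sets. As \<open>f\<close> or \<open>g\<close> is not constant, one level set is
      proper, so the induction hypothesis supplies their unique product.\<close>
    have level: "\<exists>a b. unique_product A B a b \<and> f a = u \<and> g b = v"
      if u: "u \<in> f ` A" and v: "v \<in> g ` B"
        and extreme: "\<And>a b. a \<in> A \<Longrightarrow> b \<in> B \<Longrightarrow> f a + g b = u + v \<Longrightarrow> f a = u \<and> g b = v"
      for u v
    proof -
      define A' where "A' = {a\<in>A. f a = u}"
      define B' where "B' = {b\<in>B. g b = v}"
      have fin': "finite A'" "finite B'" and sub': "A' \<subseteq> A" "B' \<subseteq> B"
        using fin by (auto simp: A'_def B'_def)
      have "A' \<noteq> A \<or> B' \<noteq> B"
      proof (rule ccontr)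
        assume "\<not> ?thesis"
        then have "\<forall>a\<in>A. f a = u" "\<forall>b\<in>B. g b = v"
          by (auto simp: A'_def B'_def)
        then show False using nonconst a0 b0 by metis
      qed
      then have "card A' + card B' < card A + card B"
        using psubset_card_mono[OF fin(1), of A'] psubset_card_mono[OF fin(2), of B']
          card_mono[OF fin(1) sub'(1)] card_mono[OF fin(2) sub'(2)] sub'
        by fastforce
      moreover have "A' \<noteq> {}" "B' \<noteq> {}"
        using u v by (auto simp: A'_def B'_def)
      ultimately obtain a b where ab: "unique_product A' B' a b"
        using less.hyps[of A' B'] fin' order_trans[OF sub'(1) sub(1)] order_trans[OF sub'(2) sub(2)] by auto
      have "a' = a \<and> b' = b" if "a' \<in> A" "b' \<in> B" "a' \<otimes> b' = a \<otimes> b" for a' b'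
      proof -
        have "f a' + g b' = u + v"
          using fg[of a' b' a b] that ab by (auto simp: unique_product_def A'_def B'_def)
        then have "a' \<in> A'" "b' \<in> B'"
          using extreme[of a' b'] that by (auto simp: A'_def B'_def)
        then show ?thesis using ab that by (auto simp: unique_product_def)
      qed
      then have "unique_product A B a b \<and> f a = u \<and> g b = v"
        using ab by (auto simp: unique_product_def A'_def B'_def)
      then show ?thesis by blast
    qed
    have finI: "finite (f ` A)" "finite (g ` B)" and neI: "f ` A \<noteq> {}" "g ` B \<noteq> {}"
      using fin a0 b0 by auto
    have max: "f a \<le> Max (f ` A)" "Min (f ` A) \<le> f a" if "a \<in> A" for a
      using finI that by simp_all
    have max': "g b \<le> Max (g ` B)" "Min (g ` B) \<le> g b" if "b \<in> B" for b
      using finI that by simp_all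
    have "f a = Max (f ` A) \<and> g b = Max (g ` B)"
      if "a \<in> A" "b \<in> B" "f a + g b = Max (f ` A) + Max (g ` B)" for a b
      using max[OF that(1)] max'[OF that(2)] that(3) by linarith
    then obtain a b where ab: "unique_product A B a b" "f a = Max (f ` A)" "g b = Max (g ` B)"
      using level[OF Max_in[OF finI(1) neI(1)] Max_in[OF finI(2) neI(2)]] by auto
    have "f a = Min (f ` A) \<and> g b = Min (g ` B)"
      if "a \<in> A" "b \<in> B" "f a + g b = Min (f ` A) + Min (g ` B)" for a b
      using max[OF that(1)] max'[OF that(2)] that(3) by linarith
    then obtain c d where cd: "unique_product A B c d" "f c = Min (f ` A)" "g d = Min (g ` B)"
      using level[OF Min_in[OF finI(1) neI(1)] Min_in[OF finI(2) neI(2)]] by auto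
    have "f c + g d < f a + g b"
      using nonconst
    proof (elim disjE bexE)
      fix a1 assume "a1 \<in> A" "f a1 \<noteq> f a0"
      then show ?thesis
        using max[of a1] max[of a0] max'[of b0] a0 b0 ab cd by simp
    next
      fix b1 assume "b1 \<in> B" "g b1 \<noteq> g b0"
      then show ?thesis
        using max'[of b1] max'[of b0] max[of a0] a0 b0 ab cd by simp
    qed
    then have "a \<otimes> b \<noteq> c \<otimes> d"
      using fg[of a b c d] ab cd by (auto simp: unique_product_def)
    then show ?thesis
      using ab cd by blast
  qed
qed

section \<open>Compact open sets and locally constant functions\<close>

text \<open>Inside a compact neighbourhood \<open>K\<close> connected sets have at most one point,
  so the cut wire fence theorem separates \<open>x\<close> from the rim \<open>K - V\<close> by a
  relatively clopen set.\<close>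

lemma compact_open_base:
  assumes "totally_disconnected_space X" "locally_compact_space X" "Hausdorff_space X"
    and U: "openin X U" "x \<in> U"
  obtains W where "openin X W" "compactin X W" "x \<in> W" "W \<subseteq> U"
proof -
  have "neighbourhood_base_of (\<lambda>C. compactin X C \<and> closedin X C) X"
    using locally_compact_space_neighbourhood_base_closedin assms(2,3) locally_compact_Hausdorff_or_regular by blast
  then obtain V K where V: "openin X V" "x \<in> V" "V \<subseteq> K" "K \<subseteq> U" and K: "compactin X K" "closedin X K"
    using U unfolding neighbourhood_base_of by meson
  let ?K = "subtopology X K"
  have KX: "K \<subseteq> topspace X"
    using K(2) closedin_subset by blast
  have "separated_between ?K {x} (K - V)"
  proof (rule cut_wire_fence_theorem)
    show "compact_space ?K" "Hausdorff_space ?K"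
      using K assms by (simp_all add: compact_space_subtopology Hausdorff_space_subtopology)
    show "closedin ?K {x}"
      using V KX \<open>Hausdorff_space ?K\<close> by (simp add: closedin_Hausdorff_singleton subset_iff)
    show "closedin ?K (K - V)"
      using V(1) K(2) by (metis Diff_Diff_Int Diff_subset closedin_diff closedin_subset_topspace)
    show "disjnt C {x} \<or> disjnt C (K - V)" if "connectedin ?K C" for C
    proof -
      from that have "connectedin X C"
        by (simp add: connectedin_subtopology)
      then obtain a where "C \<subseteq> {a}"
        using assms(1) by (auto simp: totally_disconnected_space_def)
      then show ?thesis using V by (auto simp: disjnt_def)
    qed
  qed
  then obtain W where W: "closedin ?K W" "openin ?K W" "x \<in> W" "W \<inter> (K - V) = {}"
    unfolding separated_between by (metis Diff_disjoint disjoint_iff insert_subset subset_iff)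
  have "W \<subseteq> K"
    using W(1) closedin_subset by fastforce
  then have "W \<subseteq> V"
    using W(4) by blast
  obtain T where "openin X T" "W = T \<inter> K"
    using W(2) by (auto simp: openin_subtopology)
  \<comment> \<open>A set that is relatively open in \<open>K\<close> and contained in the open set
    \<open>V \<subseteq> K\<close> is open in the whole space.\<close>
  then have "W = T \<inter> V"
    using \<open>W \<subseteq> V\<close> V(3) by blast
  then have "openin X W"
    using V(1) \<open>openin X T\<close> by blast
  moreover have "compactin X W"
    using W(1) K by (meson closedin_trans_full closed_compactin \<open>W \<subseteq> K\<close>)
  ultimately show thesis
    using that W(3) \<open>W \<subseteq> V\<close> V by blast
qed

lemma locally_constant_const: "locally_constant_on_space X (\<lambda>x. c)"
  by (auto simp: locally_constant_on_space_def)

lemma locally_constant_combine: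
  assumes "locally_constant_on_space X f" "locally_constant_on_space X g"
  shows "locally_constant_on_space X (\<lambda>x. h (f x) (g x))"
  unfolding locally_constant_on_space_def
proof
  fix x assume x: "x \<in> topspace X"
  obtain U where U: "openin X U" "x \<in> U" "\<forall>y\<in>U. f y = f x"
    using assms(1) x by (auto simp: locally_constant_on_space_def)
  obtain V where V: "openin X V" "x \<in> V" "\<forall>y\<in>V. g y = g x"
    using assms(2) x by (auto simp: locally_constant_on_space_def)
  show "\<exists>W. openin X W \<and> x \<in> W \<and> (\<forall>y\<in>W. h (f y) (g y) = h (f x) (g x))"
  proof (intro exI conjI ballI)
    show "openin X (U \<inter> V)" "x \<in> U \<inter> V"
      using U V by auto
    show "h (f y) (g y) = h (f x) (g x)" if "y \<in> U \<inter> V" for y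
      using U(3)[rule_format, of y] V(3)[rule_format, of y] that by simp
  qed
qed

lemma locally_constant_level_open:
  assumes "locally_constant_on_space X f"
  shows "openin X {x \<in> topspace X. f x \<in> A}"
proof (subst openin_subopen, clarify)
  fix x assume x: "x \<in> topspace X" "f x \<in> A"
  obtain U where U: "openin X U" "x \<in> U" "\<forall>y\<in>U. f y = f x"
    using assms x by (auto simp: locally_constant_on_space_def)
  show "\<exists>U. openin X U \<and> x \<in> U \<and> U \<subseteq> {x \<in> topspace X. f x \<in> A}"
  proof (intro exI conjI subsetI)
    show "y \<in> {x \<in> topspace X. f x \<in> A}" if "y \<in> U" for y
      using U(3)[rule_format, OF that] x(2) openin_subset[OF U(1)] that by auto
  qed (use U in auto)
qed

lemma locally_constantI:
  assumes "\<And>v. openin X {x \<in> topspace X. f x = v}"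
  shows "locally_constant_on_space X f"
  unfolding locally_constant_on_space_def
proof
  fix x assume "x \<in> topspace X"
  then show "\<exists>U. openin X U \<and> x \<in> U \<and> (\<forall>y\<in>U. f y = f x)"
    using assms[of "f x"] by (intro exI[of _ "{y \<in> topspace X. f y = f x}"]) auto
qed

text \<open>The zero level of a locally constant function is open, so the support is already closed;
  a compact superset then makes it compact.\<close>

lemma LcI:
  assumes f: "locally_constant_on_space X f" and "supp f \<subseteq> K" "compactin X K"
  shows "f \<in> Lc X"
proof -
  have "supp f = topspace X - {x \<in> topspace X. f x \<in> {0}}"
    using assms(2) compactin_subset_topspace[OF assms(3)] by (auto simp: supp_def)
  then have "closedin X (supp f)"
    using locally_constant_level_open[OF f, of "{0}"] by auto
  then have "compactin X (supp f)"
    using assms by (meson closed_compactin)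
  then show ?thesis
    using f by (simp add: Lc_def)
qed

lemma Lc_supp: "f \<in> Lc X \<Longrightarrow> compactin X (supp f)" "f \<in> Lc X \<Longrightarrow> supp f \<subseteq> topspace X"
  by (auto simp: Lc_def dest: compactin_subset_topspace)

lemma Lc_zero: "(\<lambda>x. 0) \<in> Lc X"
  by (rule LcI[of _ _ "{}"]) (auto simp: supp_def locally_constant_const)

lemma Lc_level_open:
  assumes "f \<in> Lc X" "0 \<notin> A"
  shows "openin X {x. f x \<in> A}"
proof -
  have "{x. f x \<in> A} = {x \<in> topspace X. f x \<in> A}"
    using Lc_supp(2)[OF assms(1)] assms(2) unfolding supp_def by auto
  then show ?thesis
    using locally_constant_level_open[of X f A] assms by (simp add: Lc_def)
qed

lemma Lc_supp_open: "f \<in> Lc X \<Longrightarrow> openin X (supp f)"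
  using Lc_level_open[of f X "-{0}"] by (simp add: supp_def)

text \<open>A compact support is closed in a Hausdorff space, which makes the zero level open; only
  the nonzero values are left to check.\<close>

lemma Hausdorff_LcI:
  assumes "Hausdorff_space X" "compactin X (supp f)" "\<And>v. v \<noteq> 0 \<Longrightarrow> openin X {x. f x = v}"
  shows "f \<in> Lc X"
proof -
  have "openin X {x \<in> topspace X. f x = v}" for v
  proof (cases "v = 0")
    case True
    then have "{x \<in> topspace X. f x = v} = topspace X - supp f"
      by (auto simp: supp_def)
    then show ?thesis
      using compactin_imp_closedin[OF assms(1,2)] by auto
  next
    case False
    show ?thesis
    proof -
      have "{x \<in> topspace X. f x = v} = {x. f x = v}"
        using openin_subset[OF assms(3)[OF False]] by auto
      then show ?thesis using assms(3)[OF False] by simp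
    qed
  qed
  then show ?thesis
    using assms(2) by (simp add: Lc_def locally_constantI)
qed

lemma Lc_add:
  fixes f g :: "'a \<Rightarrow> 'r::comm_ring_1"
  assumes "f \<in> Lc X" "g \<in> Lc X"
  shows "(\<lambda>x. f x + g x) \<in> Lc X"
proof (rule LcI)
  show "locally_constant_on_space X (\<lambda>x. f x + g x)"
    using assms locally_constant_combine by (auto simp: Lc_def)
  show "compactin X (supp f \<union> supp g)"
    using assms by (simp add: Lc_supp compactin_Un)
qed (auto simp: supp_def)

lemma Lc_scale:
  fixes f :: "'a \<Rightarrow> 'r::comm_ring_1"
  assumes "f \<in> Lc X"
  shows "(\<lambda>x. r * f x) \<in> Lc X"
proof (rule LcI)
  show "locally_constant_on_space X (\<lambda>x. r * f x)"
    using assms locally_constant_combine[of X f f "\<lambda>u v. r * u"] by (auto simp: Lc_def)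
  show "supp (\<lambda>x. r * f x) \<subseteq> supp f" "compactin X (supp f)"
    using assms by (auto simp: supp_def Lc_def)
qed

lemma Lc_sum:
  fixes f :: "'i \<Rightarrow> 'a \<Rightarrow> 'r::comm_ring_1"
  assumes "\<And>i. i \<in> I \<Longrightarrow> f i \<in> Lc X"
  shows "(\<lambda>x. \<Sum>i\<in>I. f i x) \<in> Lc X"
  using assms by (induction I rule: infinite_finite_induct) (auto simp: Lc_zero Lc_add)

lemma Lc_indicator:
  assumes "Hausdorff_space X" "compactin X B" "openin X B"
  shows "(\<lambda>x. if x \<in> B then 1 else 0 :: 'r::comm_ring_1) \<in> Lc X"
proof (rule Hausdorff_LcI[OF assms(1)])
  show "compactin X (supp (\<lambda>x. if x \<in> B then 1 else 0 :: 'r))"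
    using assms by (simp add: supp_def)
  fix v :: 'r assume "v \<noteq> 0"
  then have "{x. (if x \<in> B then 1 else 0) = v} = (if v = 1 then B else {})"
    by auto
  then show "openin X {x. (if x \<in> B then 1 else 0) = v}"
    using assms by simp
qed

lemma convolution_nonzeroD:
  assumes "convolution \<G> f g c \<noteq> 0"
  shows "\<exists>a b. composable \<G> a b \<and> gmult \<G> a b = c \<and> f a \<noteq> 0 \<and> g b \<noteq> 0"
proof (rule ccontr)
  assume "\<not> ?thesis"
  then have "{(a, b). composable \<G> a b \<and> gmult \<G> a b = c \<and> f a \<noteq> 0 \<and> g b \<noteq> 0} = {}"
    by auto
  with assms show False
    unfolding convolution_def by (metis sum.empty)
qed

section \<open>The transformation groupoid\<close>

locale ample_action = partial_action +
  assumes totally_disconnected: "totally_disconnected_space X"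
    and locally_compact: "locally_compact_space X"
    and Hausdorff: "Hausdorff_space X"
begin

abbreviation "Ar \<equiv> topspace (arrows \<G>)"
abbreviation "src \<equiv> gsource \<G>"
abbreviation "rng \<equiv> grange \<G>"
abbreviation "units \<equiv> gunits \<G>"
abbreviation "cmp \<equiv> composable \<G>"
abbreviation "iv \<equiv> ginv \<G>"
abbreviation mul (infixl "\<bullet>\<bullet>" 70) where "a \<bullet>\<bullet> b \<equiv> gmult \<G> a b"

lemma mul_pair: "(s, y) \<bullet>\<bullet> (t, x) = (s \<otimes> t, y)"
  by (simp add: transformation_groupoid_def)

lemma iv_pair: "iv (t, x) = (inv t, \<theta> (inv t) x)"
  by (simp add: transformation_groupoid_def)

lemma Ar_pair [simp]: "(t, x) \<in> Ar \<longleftrightarrow> t \<in> carrier G \<and> x \<in> D t"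
  by (simp add: arrows_transformation)

lemma act_cancel:
  assumes "t \<in> carrier G" "x \<in> D t" shows "\<theta> t (\<theta> (inv t) x) = x"
  using homeo[of t] dom_subset[of t] assms by (auto simp: homeomorphic_maps_def)

lemma iv_in: "a \<in> Ar \<Longrightarrow> iv a \<in> Ar"
  by (cases a) (simp add: iv_pair act_inv_in)

lemma iv_iv: "a \<in> Ar \<Longrightarrow> iv (iv a) = a"
  by (cases a) (simp add: iv_pair act_cancel)

lemma src_iv: "a \<in> Ar \<Longrightarrow> src (iv a) = rng a"
  by (cases a) (simp add: iv_pair act_cancel source_transformation range_transformation)

lemma rng_iv: "a \<in> Ar \<Longrightarrow> rng (iv a) = src a"
  by (cases a) (simp add: iv_pair source_transformation range_transformation)

lemma src_units: "a \<in> Ar \<Longrightarrow> src a \<in> units"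
  unfolding gunits_def by blast

lemma rng_units: "a \<in> Ar \<Longrightarrow> rng a \<in> units"
  using src_units[of "iv a"] by (simp add: iv_in src_iv)

lemma unit_facts:
  assumes "u \<in> units"
  shows "u \<in> Ar" "src u = u" "rng u = u"
  using assms unfolding units_transformation
  by (auto simp: dom_one source_transformation range_transformation act_one)

lemma comp_iff: "cmp a b \<longleftrightarrow> a \<in> Ar \<and> b \<in> Ar \<and> src a = rng b"
  by (rule composable_transformation)

lemma mul_in: "cmp a b \<Longrightarrow> a \<bullet>\<bullet> b \<in> Ar"
  by (rule mult_transformation_closed)

lemma rng_mul: "cmp a b \<Longrightarrow> rng (a \<bullet>\<bullet> b) = rng a"
  by (cases a; cases b) (auto simp: comp_iff mul_pair range_transformation)

lemma src_mul: assumes "cmp a b" shows "src (a \<bullet>\<bullet> b) = src b"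
proof -
  obtain s y t x where ab: "a = (s, y)" "b = (t, x)"
    by (cases a; cases b)
  with assms have *: "s \<in> carrier G" "y \<in> D s" "t \<in> carrier G" "x \<in> D t" "\<theta> (inv s) y = x"
    by (auto simp: comp_iff source_transformation range_transformation)
  \<comment> \<open>This membership is the domain condition of \<open>act_act\<close> for
    \<open>inv t\<close> and \<open>inv s\<close>; it comes from the closure of the arrows under
    composition.\<close>
  have "y \<in> D (s \<otimes> t)"
    using mul_in[OF assms] by (simp add: ab mul_pair)
  then have "\<theta> (inv t) (\<theta> (inv s) y) = \<theta> (inv t \<otimes> inv s) y"
    using * by (intro act_act) auto
  then show ?thesis
    using * by (simp add: ab mul_pair source_transformation inv_mult_group)
qed

lemma left_cancel: "cmp a b \<Longrightarrow> cmp a b' \<Longrightarrow> a \<bullet>\<bullet> b = a \<bullet>\<bullet> b' \<Longrightarrow> b = b'"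
  by (cases a; cases b; cases b')
    (auto simp: comp_iff mul_pair source_transformation range_transformation)

lemma right_cancel: "cmp a b \<Longrightarrow> cmp a' b \<Longrightarrow> a \<bullet>\<bullet> b = a' \<bullet>\<bullet> b \<Longrightarrow> a = a'"
  by (cases a; cases a'; cases b) (auto simp: comp_iff mul_pair)

lemma unit_left: "cmp u a \<Longrightarrow> u \<in> units \<Longrightarrow> u \<bullet>\<bullet> a = a \<and> rng a = u"
  by (cases a) (auto simp: units_transformation comp_iff mul_pair dom_one source_transformation range_transformation act_one)

lemma unit_right: "cmp a u \<Longrightarrow> u \<in> units \<Longrightarrow> a \<bullet>\<bullet> u = a \<and> src a = u"
  by (cases a) (auto simp: units_transformation comp_iff mul_pair dom_one source_transformation range_transformation act_one)

lemma comp_rng: "a \<in> Ar \<Longrightarrow> cmp (rng a) a" "a \<in> Ar \<Longrightarrow> rng a \<bullet>\<bullet> a = a"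
  using rng_units unit_facts unit_left[of "rng a" a] by (auto simp: comp_iff)

lemma comp_src: "a \<in> Ar \<Longrightarrow> cmp a (src a)" "a \<in> Ar \<Longrightarrow> a \<bullet>\<bullet> src a = a"
  using src_units unit_facts unit_right[of a "src a"] by (auto simp: comp_iff)

lemma comp_iv: "a \<in> Ar \<Longrightarrow> cmp a (iv a)" "a \<bullet>\<bullet> iv a = rng a" "a \<in> Ar \<Longrightarrow> cmp (iv a) a" "iv a \<bullet>\<bullet> a = src a"
  by (auto simp: comp_iff iv_in src_iv rng_iv) (auto simp: grange_def gsource_def)

text \<open>The group components multiply to \<open>\<one>\<close>, and composability fixes the
  point of the second arrow.\<close>

lemma mul_unitD:
  assumes "cmp a b" "a \<bullet>\<bullet> b \<in> units" shows "b = iv a"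
proof -
  obtain s y t x where ab: "a = (s, y)" "b = (t, x)"
    by (cases a; cases b)
  with assms have *: "s \<in> carrier G" "t \<in> carrier G" "\<theta> (inv s) y = x" "s \<otimes> t = \<one>"
    by (auto simp: comp_iff mul_pair units_transformation source_transformation range_transformation)
  then have "t = inv s"
    using inv_solve_left[of t s \<one>] by simp
  with * show ?thesis
    by (simp add: ab iv_pair)
qed

lemma rng_fst_eqD: "a \<in> Ar \<Longrightarrow> b \<in> Ar \<Longrightarrow> rng a = rng b \<Longrightarrow> fst a = fst b \<Longrightarrow> a = b"
  by (cases a; cases b) (auto simp: range_transformation)

lemma src_fst_eqD: assumes "a \<in> Ar" "b \<in> Ar" "src a = src b" "fst a = fst b" shows "a = b"
proof -
  have "iv a = iv b"
  proof (rule rng_fst_eqD)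
    show "fst (iv a) = fst (iv b)"
      using assms(4) by (cases a; cases b) (simp add: iv_pair)
  qed (use assms in \<open>auto simp: iv_in rng_iv\<close>)
  then show ?thesis
    using assms iv_iv by metis
qed

section \<open>Topology of the arrow space\<close>

lemma arrows_eq: "arrows \<G> = subtopology (prod_topology (discrete_topology (carrier G)) X)
               {(t, x). t \<in> carrier G \<and> x \<in> D t}"
  by (simp add: transformation_groupoid_def)

lemma continuous_slice:
  assumes "t \<in> carrier G"
  shows "continuous_map (subtopology X (D t)) (arrows \<G>) (Pair t)"
  unfolding arrows_eq
  using assms
  by (auto simp: continuous_map_in_subtopology intro!: continuous_map_pairedI continuous_map_from_subtopology)

text \<open>The group is discrete and each \<open>D t\<close> is open in \<open>X\<close>, so the
  arrow space is the disjoint union of its slices. Together with \<open>compactin_arrows\<close>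
  this reduces topological questions about arrows to questions about \<open>X\<close>.\<close>

lemma openin_arrows:
  "openin (arrows \<G>) W \<longleftrightarrow> W \<subseteq> Ar \<and> (\<forall>t\<in>carrier G. openin X {x. (t, x) \<in> W})"
proof safe
  assume W: "openin (arrows \<G>) W"
  then show "\<And>a b. (a, b) \<in> W \<Longrightarrow> (a, b) \<in> Ar"
    using openin_subset by blast
  fix t assume t: "t \<in> carrier G"
  have "openin (subtopology X (D t)) {x \<in> topspace (subtopology X (D t)). (t, x) \<in> W}"
    by (rule openin_continuous_map_preimage[OF continuous_slice[OF t] W])
  moreover have "{x \<in> topspace (subtopology X (D t)). (t, x) \<in> W} = {x. (t, x) \<in> W}"
    using openin_subset[OF W] subsetD[OF dom_subset[OF t]] by auto
  ultimately show "openin X {x. (t, x) \<in> W}"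
    using open_dom[OF t] openin_trans_full by metis
next
  assume W: "W \<subseteq> Ar" and slices: "\<forall>t\<in>carrier G. openin X {x. (t, x) \<in> W}"
  have eq: "W = (\<Union>t\<in>carrier G. {t} \<times> {x. (t, x) \<in> W})"
    using W by auto
  have "openin (prod_topology (discrete_topology (carrier G)) X) ({t} \<times> {x. (t, x) \<in> W})" if "t \<in> carrier G" for t
    using slices that by (simp add: openin_prod_Times_iff)
  then have "openin (prod_topology (discrete_topology (carrier G)) X) W"
    by (subst eq) blast
  then show "openin (arrows \<G>) W"
    unfolding arrows_eq openin_subtopology using W by (intro exI[of _ W]) auto
qed

lemma Hausdorff_arrows: "Hausdorff_space (arrows \<G>)"
  unfolding arrows_eq using Hausdorff
  by (simp add: Hausdorff_space_subtopology Hausdorff_space_prod_topology)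

lemma continuous_snd: "continuous_map (arrows \<G>) X snd"
  unfolding arrows_eq by (intro continuous_map_from_subtopology continuous_map_snd)

lemma continuous_fst: "continuous_map (arrows \<G>) (discrete_topology (carrier G)) fst"
  unfolding arrows_eq by (intro continuous_map_from_subtopology continuous_map_fst)

lemma clopen_group_slice:
  assumes "t \<in> carrier G"
  shows "openin (arrows \<G>) {a \<in> Ar. fst a = t}" "closedin (arrows \<G>) {a \<in> Ar. fst a = t}"
  using openin_continuous_map_preimage[OF continuous_fst, of "{t}"]
    closedin_continuous_map_preimage[OF continuous_fst, of "{t}"] assms by simp_all

text \<open>A compact set has finite image in the discrete group and meets each clopen slice in a
  compact set; conversely it is the union of finitely many compact slices.\<close>

lemma compactin_arrows:
  "compactin (arrows \<G>) W \<longleftrightarrow> W \<subseteq> Ar \<and> finite (fst ` W) \<and> (\<forall>t\<in>carrier G. compactin X {x. (t, x) \<in> W})"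
proof safe
  assume W: "compactin (arrows \<G>) W"
  then show sub: "\<And>a b. (a, b) \<in> W \<Longrightarrow> (a, b) \<in> Ar"
    using compactin_subset_topspace by blast
  show "finite (fst ` W)"
    using image_compactin[OF W continuous_fst] by (simp add: compactin_discrete_topology)
  fix t assume t: "t \<in> carrier G"
  have "compactin (arrows \<G>) (W \<inter> {a \<in> Ar. fst a = t})"
    by (rule compact_Int_closedin[OF W clopen_group_slice(2)[OF t]])
  then have "compactin X (snd ` (W \<inter> {a \<in> Ar. fst a = t}))"
    by (rule image_compactin[OF _ continuous_snd])
  moreover have "snd ` (W \<inter> {a \<in> Ar. fst a = t}) = {x. (t, x) \<in> W}"
    using sub by (force simp: image_iff)
  ultimately show "compactin X {x. (t, x) \<in> W}"
    by simp
next
  assume W: "W \<subseteq> Ar" and fin: "finite (fst ` W)" and slices: "\<forall>t\<in>carrier G. compactin X {x. (t, x) \<in> W}"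
  have eq: "W = \<Union> ((\<lambda>t. Pair t ` {x. (t, x) \<in> W}) ` fst ` W)"
    by force
  have "compactin (arrows \<G>) (Pair t ` {x. (t, x) \<in> W})" if "t \<in> fst ` W" for t
  proof -
    have t: "t \<in> carrier G"
      using W that by auto
    then have "compactin (subtopology X (D t)) {x. (t, x) \<in> W}"
      using slices W by (auto simp: compactin_subtopology)
    then show ?thesis
      by (rule image_compactin[OF _ continuous_slice[OF t]])
  qed
  then show "compactin (arrows \<G>) W"
    by (subst eq, intro compactin_Union) (use fin in auto)
qed

section \<open>Compact open bisections\<close>

definition bisections :: "('a \<times> 'c) set set"
  where "bisections = {B. openin (arrows \<G>) B \<and> compactin (arrows \<G>) B \<and> inj_on rng B \<and> inj_on src B}"

lemma bisections_subset: "B \<in> bisections \<Longrightarrow> B \<subseteq> Ar"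
  by (auto simp: bisections_def dest: compactin_subset_topspace)

lemma bisection_restrict:
  assumes "B \<in> bisections" "C \<subseteq> B" "openin (arrows \<G>) C" "compactin (arrows \<G>) C"
  shows "C \<in> bisections"
  using assms inj_on_subset unfolding bisections_def by blast

lemma bisection_Int:
  assumes "B \<in> bisections" "C \<in> bisections" shows "B \<inter> C \<in> bisections"
proof (rule bisection_restrict[OF assms(1)])
  have "closedin (arrows \<G>) C"
    using assms(2) Hausdorff_arrows compactin_imp_closedin by (auto simp: bisections_def)
  then show "compactin (arrows \<G>) (B \<inter> C)"
    using assms compact_Int_closedin by (auto simp: bisections_def)
qed (use assms in \<open>auto simp: bisections_def\<close>)

lemma bisection_Diff:
  assumes "B \<in> bisections" "C \<in> bisections" shows "B - C \<in> bisections"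
proof (rule bisection_restrict[OF assms(1)])
  have "closedin (arrows \<G>) C"
    using assms(2) Hausdorff_arrows compactin_imp_closedin by (auto simp: bisections_def)
  then show "openin (arrows \<G>) (B - C)"
    using assms by (auto simp: bisections_def)
  have "B - C = B \<inter> (Ar - C)"
    using bisections_subset[OF assms(1)] by auto
  moreover have "closedin (arrows \<G>) (Ar - C)"
    using assms by (auto simp: bisections_def)
  ultimately show "compactin (arrows \<G>) (B - C)"
    using assms compact_Int_closedin by (auto simp: bisections_def)
qed auto

lemma bisection_base:
  assumes W: "openin (arrows \<G>) W" and a: "a \<in> W"
  obtains B where "B \<in> bisections" "a \<in> B" "B \<subseteq> W"
proof -
  obtain t x where tx: "a = (t, x)" by (cases a)
  then have t: "t \<in> carrier G" and slice: "openin X {x. (t, x) \<in> W}" and WAr: "W \<subseteq> Ar"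
    using W a by (auto simp: openin_arrows)
  obtain V where V: "openin X V" "compactin X V" "x \<in> V" "V \<subseteq> {x. (t, x) \<in> W}"
    using compact_open_base[OF totally_disconnected locally_compact Hausdorff slice, of x] a tx by auto
  have sub: "{t} \<times> V \<subseteq> W"
    using V by auto
  have eq: "{x. (s, x) \<in> {t} \<times> V} = (if s = t then V else {})" for s
    by auto
  \<comment> \<open>All arrows in \<open>{t} \<times> V\<close> have the same group component, and
    an arrow is determined by this component together with either its range or its source.\<close>
  have "{t} \<times> V \<in> bisections"
    unfolding bisections_def
  proof (intro CollectI conjI)
    show "openin (arrows \<G>) ({t} \<times> V)"
      unfolding openin_arrows eq using V sub WAr by auto
    show "compactin (arrows \<G>) ({t} \<times> V)"
      unfolding compactin_arrows eq using V sub WAr by (auto simp: finite_subset[of _ "{t}"])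
    have "b = c" if "b \<in> {t} \<times> V" "c \<in> {t} \<times> V" "rng b = rng c \<or> src b = src c" for b c
    proof -
      have "b \<in> Ar" "c \<in> Ar" "fst b = fst c"
        using that sub WAr by auto
      then show ?thesis
        using rng_fst_eqD[of b c] src_fst_eqD[of b c] that(3) by blast
    qed
    then show "inj_on rng ({t} \<times> V)" "inj_on src ({t} \<times> V)"
      by (auto intro!: inj_onI)
  qed
  then show thesis
    using that V(3) sub tx by blast
qed

lemma units_clopen: "openin (arrows \<G>) units" "closedin (arrows \<G>) units"
proof -
  have "units = {a \<in> Ar. fst a = \<one>}"
    by (auto simp: units_transformation dom_one)
  then show "openin (arrows \<G>) units" "closedin (arrows \<G>) units"
    using clopen_group_slice[of \<one>] by simp_all
qed

lemma continuous_iv: "continuous_map (arrows \<G>) (arrows \<G>) iv"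
  unfolding continuous_map
proof (intro conjI allI impI)
  show "iv ` Ar \<subseteq> Ar" by (auto intro!: iv_in)
  fix W assume W: "openin (arrows \<G>) W"
  show "openin (arrows \<G>) {a \<in> Ar. iv a \<in> W}"
    unfolding openin_arrows
  proof (intro conjI ballI)
    fix t assume t: "t \<in> carrier G"
    have "continuous_map (subtopology X (D t)) (subtopology X (D (inv t))) (\<theta> (inv t))"
      using homeo[OF t] by (auto simp: homeomorphic_maps_def)
    then have "continuous_map (subtopology X (D t)) X (\<theta> (inv t))"
      by (simp add: continuous_map_in_subtopology)
    from openin_continuous_map_preimage[OF this, of "{x. (inv t, x) \<in> W}"]
    have "openin (subtopology X (D t)) {x \<in> topspace (subtopology X (D t)). (inv t, \<theta> (inv t) x) \<in> W}"
      using W t by (auto simp: openin_arrows)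
    moreover have "{x \<in> topspace (subtopology X (D t)). (inv t, \<theta> (inv t) x) \<in> W} = {x. (t, x) \<in> {a \<in> Ar. iv a \<in> W}}"
      using t dom_subset[OF t] by (auto simp: iv_pair)
    ultimately show "openin X {x. (t, x) \<in> {a \<in> Ar. iv a \<in> W}}"
      using open_dom[OF t] openin_trans_full by metis
  qed auto
qed

text \<open>Inversion is a continuous involution, so the image of \<open>B\<close> is also its
  preimage; ranges and sources are exchanged.\<close>

lemma bisection_iv:
  assumes B: "B \<in> bisections" shows "iv ` B \<in> bisections"
proof -
  have BAr: "B \<subseteq> Ar" by (rule bisections_subset[OF B])
  have "iv ` B = {a \<in> Ar. iv a \<in> B}"
    using BAr iv_iv iv_in by (force simp: image_iff)
  then have "openin (arrows \<G>) (iv ` B)"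
    using openin_continuous_map_preimage[OF continuous_iv] B by (simp add: bisections_def)
  moreover have "compactin (arrows \<G>) (iv ` B)"
    using image_compactin[OF _ continuous_iv] B by (auto simp: bisections_def)
  moreover have "inj_on rng (iv ` B)" "inj_on src (iv ` B)"
    using B BAr by (auto simp: bisections_def inj_on_def src_iv rng_iv subset_iff)
  ultimately show ?thesis
    by (simp add: bisections_def)
qed

section \<open>The Steinberg algebra\<close>

text \<open>Slice by slice, an element of the Steinberg algebra is a finitely supported family of
  functions in \<open>Lc X\<close>. Convolutions are controlled in this form, and it is also the
  form that matches the coefficient families of the skew group ring.\<close>

lemma Lc_arrows:
  fixes f :: "'a \<times> 'c \<Rightarrow> 'r::zero"
  shows "f \<in> Lc (arrows \<G>) \<longleftrightarrow>
    supp f \<subseteq> Ar \<and> finite (fst ` supp f) \<and> (\<forall>t\<in>carrier G. (\<lambda>x. f (t, x)) \<in> Lc X)"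
proof (intro iffI conjI ballI)
  assume f: "f \<in> Lc (arrows \<G>)"
  show "supp f \<subseteq> Ar" by (rule Lc_supp[OF f])
  show "finite (fst ` supp f)"
    using Lc_supp(1)[OF f] by (simp add: compactin_arrows)
  fix t assume t: "t \<in> carrier G"
  show "(\<lambda>x. f (t, x)) \<in> Lc X"
  proof (rule Hausdorff_LcI[OF Hausdorff])
    show "compactin X (supp (\<lambda>x. f (t, x)))"
      using Lc_supp(1)[OF f] t by (auto simp: compactin_arrows supp_def)
    show "openin X {x. f (t, x) = v}" if "v \<noteq> 0" for v
      using Lc_level_open[OF f, of "{v}"] that t by (auto simp: openin_arrows)
  qed
next
  assume f: "supp f \<subseteq> Ar \<and> finite (fst ` supp f) \<and> (\<forall>t\<in>carrier G. (\<lambda>x. f (t, x)) \<in> Lc X)"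
  show "f \<in> Lc (arrows \<G>)"
  proof (rule Hausdorff_LcI[OF Hausdorff_arrows])
    have "compactin X {x. (t, x) \<in> supp f}" if "t \<in> carrier G" for t
      using f Lc_supp(1)[of "\<lambda>x. f (t, x)" X] that by (simp add: supp_def)
    then show "compactin (arrows \<G>) (supp f)"
      unfolding compactin_arrows using f by blast
    show "openin (arrows \<G>) {a. f a = v}" if "v \<noteq> 0" for v
      unfolding openin_arrows
    proof (intro conjI ballI)
      show "{a. f a = v} \<subseteq> Ar"
        using f that by (auto simp: supp_def)
      show "openin X {x. (t, x) \<in> {a. f a = v}}" if "t \<in> carrier G" for t
        using f Lc_level_open[of "\<lambda>x. f (t, x)" X "{v}"] \<open>v \<noteq> 0\<close> that by simp
    qed
  qed
qed

text \<open>Factorizations of \<open>(k, x)\<close> are parametrized by the two group components: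
  the first arrow has range point \<open>x\<close>, hence is \<open>(s, x)\<close>, and the second
  is then \<open>(t, \<theta> (inv s) x)\<close>. Summing over fixed finite sets of components gives
  the double sum that occurs in \<open>skew_mult\<close>.\<close>

lemma convolution_pair:
  fixes f g :: "'a \<times> 'c \<Rightarrow> 'r::comm_ring_1"
  assumes "f \<in> Lc (arrows \<G>)" "g \<in> Lc (arrows \<G>)"
  shows "convolution \<G> f g (k, x) =
    (\<Sum>s\<in>fst ` supp f. \<Sum>t\<in>fst ` supp g. if s \<otimes> t = k then f (s, x) * g (t, \<theta> (inv s) x) else 0)"
proof -
  let ?S = "fst ` supp f" and ?T = "fst ` supp g"
  let ?e = "\<lambda>(s, t). ((s, x), (t, \<theta> (inv s) x))"
  let ?P = "{(c, d). cmp c d \<and> c \<bullet>\<bullet> d = (k, x) \<and> f c \<noteq> 0 \<and> g d \<noteq> 0}"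
  let ?Q = "{(s, t) \<in> ?S \<times> ?T. s \<otimes> t = k \<and> f (s, x) \<noteq> 0 \<and> g (t, \<theta> (inv s) x) \<noteq> 0}"
  have fin: "finite ?S" "finite ?T" and Ar: "supp f \<subseteq> Ar" "supp g \<subseteq> Ar"
    using assms by (auto simp: Lc_arrows)
  have in_Ar: "c \<in> Ar" if "f c \<noteq> 0 \<or> g c \<noteq> 0" for c
    using Ar that unfolding supp_def by blast
  have P: "?P = ?e ` ?Q"
  proof
    show "?P \<subseteq> ?e ` ?Q"
    proof clarify
      fix s y t z assume *: "cmp (s, y) (t, z)" "(s, y) \<bullet>\<bullet> (t, z) = (k, x)" "f (s, y) \<noteq> 0" "g (t, z) \<noteq> 0"
      then have "y = x" "s \<otimes> t = k" "z = \<theta> (inv s) x"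
        by (auto simp: comp_iff mul_pair source_transformation range_transformation)
      with * show "((s, y), (t, z)) \<in> ?e ` ?Q"
      proof (intro image_eqI[of _ _ "(s, t)"])
        have "s \<in> fst ` supp f" "t \<in> fst ` supp g"
          using * by (force simp: supp_def)+
        then show "(s, t) \<in> ?Q"
          using * \<open>y = x\<close> \<open>s \<otimes> t = k\<close> \<open>z = \<theta> (inv s) x\<close> by simp
      qed simp
    qed
    show "?e ` ?Q \<subseteq> ?P"
    proof clarify
      fix s t assume *: "f (s, x) \<noteq> 0" "g (t, \<theta> (inv s) x) \<noteq> 0"
      then have "(s, x) \<in> Ar" "(t, \<theta> (inv s) x) \<in> Ar"
        using in_Ar by blast+
      then show "cmp (s, x) (t, \<theta> (inv s) x) \<and> (s, x) \<bullet>\<bullet> (t, \<theta> (inv s) x) = (s \<otimes> t, x) \<and>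
          f (s, x) \<noteq> 0 \<and> g (t, \<theta> (inv s) x) \<noteq> 0"
        using * by (simp add: comp_iff mul_pair source_transformation range_transformation)
    qed
  qed
  have "inj_on ?e ?Q"
    by (auto simp: inj_on_def)
  then have "convolution \<G> f g (k, x) = (\<Sum>(s, t)\<in>?Q. f (s, x) * g (t, \<theta> (inv s) x))"
    unfolding convolution_def P by (subst sum.reindex) (auto intro!: sum.cong)
  also have "\<dots> = (\<Sum>(s, t)\<in>?S \<times> ?T. if s \<otimes> t = k then f (s, x) * g (t, \<theta> (inv s) x) else 0)"
    using fin by (intro sum.mono_neutral_cong_left) (auto split: if_splits)
  finally show ?thesis
    by (simp add: sum.cartesian_product)
qed

text \<open>One summand of the preceding formula. On \<open>D s\<close> the map
  \<open>\<theta> (inv s)\<close> is continuous; at a point outside \<open>D s\<close>, where its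
  values carry no meaning, \<open>f\<close> vanishes on a neighbourhood.\<close>

lemma Lc_twisted_mult:
  fixes f g :: "'c \<Rightarrow> 'r::comm_ring_1"
  assumes s: "s \<in> carrier G" and f: "f \<in> Lc X" "supp f \<subseteq> D s" and g: "g \<in> Lc X"
  shows "(\<lambda>x. f x * g (\<theta> (inv s) x)) \<in> Lc X"
proof (rule LcI)
  show "locally_constant_on_space X (\<lambda>x. f x * g (\<theta> (inv s) x))"
    unfolding locally_constant_on_space_def
  proof
    fix x assume x: "x \<in> topspace X"
    obtain U where U: "openin X U" "x \<in> U" "\<forall>y\<in>U. f y = f x"
      using f(1) x unfolding Lc_def locally_constant_on_space_def by blast
    show "\<exists>U. openin X U \<and> x \<in> U \<and> (\<forall>y\<in>U. f y * g (\<theta> (inv s) y) = f x * g (\<theta> (inv s) x))"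
    proof (cases "x \<in> D s")
      case True
      have "continuous_map (subtopology X (D s)) (subtopology X (D (inv s))) (\<theta> (inv s))"
        using homeo[OF s] by (auto simp: homeomorphic_maps_def)
      then have cont: "continuous_map (subtopology X (D s)) X (\<theta> (inv s))"
        by (simp add: continuous_map_in_subtopology)
      have "\<theta> (inv s) x \<in> topspace X"
        using act_inv_in[OF s True] dom_subset[of "inv s"] s by auto
      then obtain V where V: "openin X V" "\<theta> (inv s) x \<in> V" "\<forall>y\<in>V. g y = g (\<theta> (inv s) x)"
        using g unfolding Lc_def locally_constant_on_space_def by blast
      have "openin (subtopology X (D s)) {y \<in> topspace (subtopology X (D s)). \<theta> (inv s) y \<in> V}"
        by (rule openin_continuous_map_preimage[OF cont V(1)])
      then have "openin X {y \<in> topspace (subtopology X (D s)). \<theta> (inv s) y \<in> V}"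
        using open_dom[OF s] openin_trans_full by metis
      then have "openin X (U \<inter> {y \<in> topspace (subtopology X (D s)). \<theta> (inv s) y \<in> V})"
        using U(1) by auto
      moreover have "f y * g (\<theta> (inv s) y) = f x * g (\<theta> (inv s) x)"
        if "y \<in> U \<inter> {y \<in> topspace (subtopology X (D s)). \<theta> (inv s) y \<in> V}" for y
        using U(3)[rule_format, of y] V(3)[rule_format, of "\<theta> (inv s) y"] that by simp
      moreover have "x \<in> U \<inter> {y \<in> topspace (subtopology X (D s)). \<theta> (inv s) y \<in> V}"
        using U V x True by simp
      ultimately show ?thesis
        by blast
    next
      case False
      then have "f x = 0"
        using f(2) by (auto simp: supp_def)
      then have "f y * g (\<theta> (inv s) y) = f x * g (\<theta> (inv s) x)" if "y \<in> U" for y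
        using U(3)[rule_format, OF that] by simp
      then show ?thesis
        using U(1,2) by blast
    qed
  qed
  show "compactin X (supp f)"
    by (rule Lc_supp[OF f(1)])
qed (auto simp: supp_def)

lemma Lc_convolution:
  fixes f g :: "'a \<times> 'c \<Rightarrow> 'r::comm_ring_1"
  assumes f: "f \<in> Lc (arrows \<G>)" and g: "g \<in> Lc (arrows \<G>)"
  shows "convolution \<G> f g \<in> Lc (arrows \<G>)"
  unfolding Lc_arrows
proof (intro conjI ballI)
  have fin: "finite (fst ` supp f)" "finite (fst ` supp g)" and Ar: "supp f \<subseteq> Ar" "supp g \<subseteq> Ar"
    using assms by (auto simp: Lc_arrows)
  show "supp (convolution \<G> f g) \<subseteq> Ar"
  proof
    fix c assume "c \<in> supp (convolution \<G> f g)"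
    then show "c \<in> Ar"
      using convolution_nonzeroD[of \<G> f g c] mul_in by (auto simp: supp_def)
  qed
  have "fst ` supp (convolution \<G> f g) \<subseteq> (\<lambda>(s, t). s \<otimes> t) ` (fst ` supp f \<times> fst ` supp g)"
  proof clarify
    fix k x assume "(k, x) \<in> supp (convolution \<G> f g)"
    then obtain s y t z where *: "(s, y) \<bullet>\<bullet> (t, z) = (k, x)" "f (s, y) \<noteq> 0" "g (t, z) \<noteq> 0"
      using convolution_nonzeroD[of \<G> f g "(k, x)"] by (auto simp: supp_def)
    then have "s \<in> fst ` supp f" "t \<in> fst ` supp g" "k = s \<otimes> t"
      by (force simp: supp_def image_iff mul_pair)+
    then show "fst (k, x) \<in> (\<lambda>(s, t). s \<otimes> t) ` (fst ` supp f \<times> fst ` supp g)"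
      by (simp add: image_iff) blast
  qed
  then show "finite (fst ` supp (convolution \<G> f g))"
    using fin by (meson finite_SigmaI finite_imageI finite_subset)
  fix k assume "k \<in> carrier G"
  have "(\<lambda>x. if s \<otimes> t = k then f (s, x) * g (t, \<theta> (inv s) x) else 0) \<in> Lc X"
    if "s \<in> fst ` supp f" "t \<in> fst ` supp g" for s t
  proof -
    have st: "s \<in> carrier G" "t \<in> carrier G"
      using that Ar by auto
    have "supp (\<lambda>x. f (s, x)) \<subseteq> D s"
      using Ar by (auto simp: supp_def)
    then have "(\<lambda>x. f (s, x) * g (t, \<theta> (inv s) x)) \<in> Lc X"
      using Lc_twisted_mult[of s "\<lambda>x. f (s, x)" "\<lambda>x. g (t, x)"] assms st by (simp add: Lc_arrows)
    then show ?thesis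
      by (cases "s \<otimes> t = k") (simp_all add: Lc_zero)
  qed
  then show "(\<lambda>x. convolution \<G> f g (k, x)) \<in> Lc X"
    unfolding convolution_pair[OF f g] by (intro Lc_sum)
qed

end

section \<open>Bisections and normalizers\<close>

definition char_fun :: "'m set \<Rightarrow> 'm \<Rightarrow> 'r::comm_ring_1"
  where "char_fun B = (\<lambda>a. if a \<in> B then 1 else 0)"

lemma supp_char_fun [simp]: "supp (char_fun B :: 'm \<Rightarrow> 'r::comm_ring_1) = B"
  by (simp add: supp_def char_fun_def)

lemma in_supp: "a \<in> supp f \<longleftrightarrow> f a \<noteq> 0"
  by (simp add: supp_def)

lemma convolution_nonzeroE:
  assumes "convolution \<G> f g c \<noteq> 0"
  obtains a b where "composable \<G> a b" "gmult \<G> a b = c" "f a \<noteq> 0" "g b \<noteq> 0"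
  using convolution_nonzeroD[OF assms] by blast

text \<open>Only convolution and the diagonal are mentioned, so a diagonal-preserving isomorphism
  transports the notion. The last two equations make \<open>n'\<close> a generalized inverse of
  \<open>n\<close>. Over an integral domain, and for a group that is indicable throughout, the
  explicit form of such pairs is \<open>bisection_pair\<close>.\<close>

definition normalizer_pair :: "'m top_groupoid \<Rightarrow> ('m \<Rightarrow> 'r::comm_ring_1) \<Rightarrow> ('m \<Rightarrow> 'r) \<Rightarrow> bool"
  where "normalizer_pair \<G> n n' \<longleftrightarrow>
    n \<in> Lc (arrows \<G>) \<and> n' \<in> Lc (arrows \<G>) \<and>
    (\<forall>d\<in>steinberg_diagonal \<G>. convolution \<G> (convolution \<G> n d) n' \<in> steinberg_diagonal \<G> \<and>
                               convolution \<G> (convolution \<G> n' d) n \<in> steinberg_diagonal \<G>) \<and>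
    convolution \<G> (convolution \<G> n n') n = n \<and> convolution \<G> (convolution \<G> n' n) n' = n'"

lemma normalizer_pair_sym: "normalizer_pair \<G> n n' \<Longrightarrow> normalizer_pair \<G> n' n"
  by (auto simp: normalizer_pair_def)

lemma diagonal_iff: "f \<in> steinberg_diagonal \<G> \<longleftrightarrow> f \<in> Lc (arrows \<G>) \<and> supp f \<subseteq> gunits \<G>"
  by (simp add: steinberg_diagonal_def steinberg_algebra_def)

context ample_action
begin

section \<open>Convolutions evaluated through a single factorization\<close>

lemma Lc_in_Ar: "f \<in> Lc (arrows \<G>) \<Longrightarrow> f a \<noteq> 0 \<Longrightarrow> a \<in> Ar"
  using Lc_supp(2) by (force simp: supp_def)

text \<open>The range of the product determines the left factor within the support of
  \<open>f\<close>, and cancellation determines the right one, so the convolution sum has at most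
  one term.\<close>

lemma convolution_left:
  fixes f g :: "'a \<times> 'c \<Rightarrow> 'r::comm_ring_1"
  assumes "inj_on rng (supp f)" "cmp a b" "f a \<noteq> 0"
  shows "convolution \<G> f g (a \<bullet>\<bullet> b) = f a * g b"
proof -
  have "{(c, d). cmp c d \<and> c \<bullet>\<bullet> d = a \<bullet>\<bullet> b \<and> f c \<noteq> 0 \<and> g d \<noteq> 0} = (if g b = 0 then {} else {(a, b)})"
  proof -
    have "c = a \<and> d = b" if "cmp c d" "c \<bullet>\<bullet> d = a \<bullet>\<bullet> b" "f c \<noteq> 0" for c d
    proof -
      have "rng c = rng a"
        using rng_mul[OF that(1)] rng_mul[OF assms(2)] that(2) by simp
      then have "c = a"
        using assms that by (auto simp: inj_on_def in_supp)
      then show ?thesis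
        using that assms left_cancel by blast
    qed
    then show ?thesis
      using assms by auto
  qed
  then show ?thesis
    by (simp add: convolution_def)
qed

lemma convolution_right:
  fixes f g :: "'a \<times> 'c \<Rightarrow> 'r::comm_ring_1"
  assumes "inj_on src (supp g)" "cmp a b" "g b \<noteq> 0"
  shows "convolution \<G> f g (a \<bullet>\<bullet> b) = f a * g b"
proof -
  have "{(c, d). cmp c d \<and> c \<bullet>\<bullet> d = a \<bullet>\<bullet> b \<and> f c \<noteq> 0 \<and> g d \<noteq> 0} = (if f a = 0 then {} else {(a, b)})"
  proof -
    have "c = a \<and> d = b" if "cmp c d" "c \<bullet>\<bullet> d = a \<bullet>\<bullet> b" "g d \<noteq> 0" for c d
    proof -
      have "src d = src b"
        using src_mul[OF that(1)] src_mul[OF assms(2)] that(2) by simp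
      then have "d = b"
        using assms that by (auto simp: inj_on_def in_supp)
      then show ?thesis
        using that assms right_cancel by blast
    qed
    then show ?thesis
      using assms by auto
  qed
  then show ?thesis
    by (simp add: convolution_def)
qed

text \<open>The only factorization of \<open>e\<close> with a unit on the right is \<open>e\<close>
  times \<open>src e\<close>, so a diagonal element acts from the right through its value at the
  source.\<close>

lemma convolution_diagonal:
  fixes f d :: "'a \<times> 'c \<Rightarrow> 'r::comm_ring_1"
  assumes d: "d \<in> steinberg_diagonal \<G>" and e: "e \<in> Ar"
  shows "convolution \<G> f d e = f e * d (src e)"
proof (cases "d (src e) = 0")
  case True
  have "convolution \<G> f d e = 0"
  proof (rule ccontr)
    assume "convolution \<G> f d e \<noteq> 0"
    then obtain a u where *: "cmp a u" "a \<bullet>\<bullet> u = e" "d u \<noteq> 0"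
      by (rule convolution_nonzeroE)
    then have "u \<in> units"
      using d by (auto simp: diagonal_iff supp_def)
    then show False
      using unit_right[of a u] * True by auto
  qed
  with True show ?thesis by simp
next
  case False
  have "inj_on src units"
    by (rule inj_on_inverseI[of _ "\<lambda>u. u"]) (rule unit_facts(2))
  then have "inj_on src (supp d)"
    using d inj_on_subset by (auto simp: diagonal_iff)
  from convolution_right[OF this comp_src(1)[OF e] False, of f] show ?thesis
    by (simp add: comp_src(2)[OF e])
qed

lemma Lc_char_fun: "B \<in> bisections \<Longrightarrow> char_fun B \<in> Lc (arrows \<G>)"
  unfolding char_fun_def bisections_def using Hausdorff_arrows by (auto intro: Lc_indicator)

text \<open>The witness is the indicator of a compact open neighbourhood of \<open>x\<close> inside
  \<open>units - F\<close>, which is open because finite sets are closed. It singles out the arrows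
  with source \<open>x\<close> among finitely many candidates.\<close>

lemma isolating_diagonal:
  assumes x: "x \<in> units" and F: "finite F" "F \<subseteq> Ar" "x \<notin> F"
  obtains d :: "'a \<times> 'c \<Rightarrow> 'r::comm_ring_1"
  where "d \<in> steinberg_diagonal \<G>" "d x = 1" "\<And>y. y \<in> F \<Longrightarrow> d y = 0"
proof -
  have "closedin (arrows \<G>) F"
    using F Hausdorff_arrows by (simp add: closedin_Hausdorff_finite)
  then have "openin (arrows \<G>) (units - F)"
    using units_clopen(1) by auto
  then obtain B where B: "B \<in> bisections" "x \<in> B" "B \<subseteq> units - F"
    using bisection_base[of "units - F" x] x F by blast
  have "(char_fun B :: _ \<Rightarrow> 'r) \<in> steinberg_diagonal \<G>"
    using B Lc_char_fun by (auto simp: diagonal_iff)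
  then show thesis
  proof (rule that)
    show "(char_fun B x :: 'r) = 1"
      using B by (simp add: char_fun_def)
    show "(char_fun B y :: 'r) = 0" if "y \<in> F" for y
      using B that by (auto simp: char_fun_def)
  qed
qed

lemma unit_of_fst: "a \<in> Ar \<Longrightarrow> fst a = \<one> \<Longrightarrow> a \<in> units"
  by (cases a) (simp add: units_transformation dom_one)

lemma fst_mul: "fst (a \<bullet>\<bullet> b) = fst a \<otimes> fst b"
  by (cases a; cases b) (simp add: mul_pair)

lemma fst_unit: "u \<in> units \<Longrightarrow> fst u = \<one>"
  by (auto simp: units_transformation)

text \<open>A product \<open>p \<otimes> q\<close> that is unique among the group components over the unit \<open>x\<close> gives an arrow
  at which \<open>n * 1\<^sub>W * n'\<close>, for a small neighbourhood \<open>W\<close> of \<open>x\<close>, has a single nonzero summand.\<close>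

lemma diagonal_sandwich_fibre:
  fixes n n' :: "'a \<times> 'c \<Rightarrow> 'r::idom"
  assumes ind: "indicable_throughout G"
    and n: "n \<in> Lc (arrows \<G>)" and n': "n' \<in> Lc (arrows \<G>)"
    and diag: "\<And>d. d \<in> steinberg_diagonal \<G> \<Longrightarrow>
      convolution \<G> (convolution \<G> n d) n' \<in> steinberg_diagonal \<G>"
    and ab: "cmp a b" "n a \<noteq> 0" "n' b \<noteq> 0"
  shows "b = iv a"
    and "n a' \<noteq> 0 \<Longrightarrow> src a' = src a \<Longrightarrow> a' = a"
    and "n' b' \<noteq> 0 \<Longrightarrow> rng b' = rng b \<Longrightarrow> b' = b"
proof -
  define x where "x = src a"
  have aA: "a \<in> Ar" "b \<in> Ar" "rng b = x"
    using ab by (auto simp: comp_iff x_def)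
  \<comment> \<open>The arrows of \<open>n\<close> leaving \<open>x\<close> and those of
    \<open>n'\<close> entering it. Every pair from \<open>S \<times> T\<close> is composable, so
    unique products may be sought in the sets of group components.\<close>
  define S where "S = {e. n e \<noteq> 0 \<and> src e = x}"
  define T where "T = {e. n' e \<noteq> 0 \<and> rng e = x}"
  have SA: "S \<subseteq> Ar" "T \<subseteq> Ar"
    using Lc_in_Ar n n' by (auto simp: S_def T_def)
  have aS: "a \<in> S" "b \<in> T"
    using ab aA by (auto simp: S_def T_def x_def)
  have fin: "finite (fst ` supp n)" "finite (fst ` supp n')"
    using n n' by (auto simp: Lc_arrows)
  have "S \<subseteq> supp n" "T \<subseteq> supp n'"
    by (auto simp: S_def T_def in_supp)
  then have finST: "finite (fst ` S)" "finite (fst ` T)"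
    using fin by (meson finite_subset image_mono)+
  have STc: "fst ` S \<subseteq> carrier G" "fst ` T \<subseteq> carrier G"
    using SA by auto
  have unit: "p \<otimes> q = \<one>" if up: "unique_product (fst ` S) (fst ` T) p q" for p q
  proof (rule ccontr)
    assume ne: "p \<otimes> q \<noteq> \<one>"
    obtain s t where st: "s \<in> S" "t \<in> T" "fst s = p" "fst t = q"
      using up by (auto simp: unique_product_def)
    have cst: "cmp s t"
      using st SA by (auto simp: comp_iff S_def T_def)
    define c where "c = s \<bullet>\<bullet> t"
    have cn: "c \<notin> units"
      using ne st fst_unit[of c] by (auto simp: c_def fst_mul)
    \<comment> \<open>\<open>E\<close> contains the possible left factors of \<open>c\<close>. It is
      finite because arrows with a common range differ in their group components, of which
      \<open>supp n\<close> has finitely many; so \<open>d\<close> has to vanish at only finitely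
      many sources other than \<open>x\<close>.\<close>
    define E where "E = {e \<in> supp n. rng e = rng c}"
    have EA: "E \<subseteq> Ar"
      using Lc_in_Ar[OF n] by (auto simp: E_def in_supp)
    have "inj_on fst E"
    proof (rule inj_onI)
      fix e e' assume "e \<in> E" "e' \<in> E" "fst e = fst e'"
      then show "e = e'"
        using subsetD[OF EA, of e] subsetD[OF EA, of e'] rng_fst_eqD[of e e'] by (simp add: E_def)
    qed
    moreover have "finite (fst ` E)"
      using fin(1) by (rule finite_subset[rotated]) (auto simp: E_def)
    ultimately have "finite E"
      by (rule finite_imageD[rotated])
    then have F: "finite (src ` E - {x})" by simp
    have FA: "src ` E - {x} \<subseteq> Ar"
      using EA src_units unit_facts(1) by blast
    have xu: "x \<in> units"
      unfolding x_def using aA src_units by blast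
    obtain d :: "'a \<times> 'c \<Rightarrow> 'r" where d: "d \<in> steinberg_diagonal \<G>" "d x = 1"
        "\<And>y. y \<in> src ` E - {x} \<Longrightarrow> d y = 0"
      using isolating_diagonal[OF xu F FA] by blast
    let ?nd = "convolution \<G> n d"
    have nd: "?nd e = n e * d (src e)" if "e \<in> Ar" for e
      by (rule convolution_diagonal[OF d(1) that])
    have "{(e, e'). cmp e e' \<and> e \<bullet>\<bullet> e' = c \<and> ?nd e \<noteq> 0 \<and> n' e' \<noteq> 0} = {(s, t)}"
    proof -
      have "e = s \<and> e' = t" if e: "cmp e e'" "e \<bullet>\<bullet> e' = c" "?nd e \<noteq> 0" "n' e' \<noteq> 0" for e e'
      proof -
        have eA: "e \<in> Ar" "e' \<in> Ar" "src e = rng e'"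
          using e(1) by (auto simp: comp_iff)
        have ne0: "n e \<noteq> 0" "d (src e) \<noteq> 0"
          using e(3) nd[OF eA(1)] by auto
        have r: "rng e = rng c"
          using rng_mul[OF e(1)] e(2) by simp
        then have "e \<in> E"
          using ne0 by (simp add: E_def in_supp)
        then have sx: "src e = x"
          using d(3) ne0(2) by blast
        then have "e \<in> S" "e' \<in> T"
          using ne0 e(4) eA by (auto simp: S_def T_def)
        moreover have "fst e \<otimes> fst e' = p \<otimes> q"
          using fst_mul[of e e'] fst_mul[of s t] e(2) st by (simp add: c_def)
        ultimately have "fst e = p \<and> fst e' = q"
          using up unfolding unique_product_def by blast
        moreover have "rng e = rng s" "rng e' = rng t"
          using r rng_mul[OF cst] sx eA st by (auto simp: c_def T_def)
        ultimately show ?thesis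
          using rng_fst_eqD[OF eA(1) subsetD[OF SA(1) st(1)]] rng_fst_eqD[OF eA(2) subsetD[OF SA(2) st(2)]] st
          by simp
      qed
      moreover have "?nd s \<noteq> 0 \<and> n' t \<noteq> 0"
        using nd[of s] st SA d(2) by (auto simp: S_def T_def)
      ultimately show ?thesis
        using cst by (auto simp: c_def)
    qed
    \<comment> \<open>The one remaining summand is \<open>n s * n' t\<close>, which is nonzero in an
      integral domain, at the non-unit \<open>c\<close>.\<close>
    then have "convolution \<G> ?nd n' c = ?nd s * n' t"
      by (simp add: convolution_def)
    also have "\<dots> \<noteq> 0"
      using nd[of s] st SA d(2) by (auto simp: S_def T_def)
    finally show False
      using diag[OF d(1)] cn by (auto simp: diagonal_iff supp_def)
  qed
  have "fst ` S \<noteq> {}" "fst ` T \<noteq> {}"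
    using aS by auto
  \<comment> \<open>Every unique product equals \<open>\<one>\<close>, so two with different values
    cannot exist and both component sets are singletons.\<close>
  note two = two_unique_products[OF ind finST this STc]
  then obtain p q where pq: "fst ` S = {p}" "fst ` T = {q}" "p \<otimes> q = \<one>"
    using unit by (metis singletonD unique_product_def)
  have "fst a = p" "fst b = q"
    using pq aS by blast+
  then have "fst (a \<bullet>\<bullet> b) = \<one>"
    using pq by (simp add: fst_mul)
  then have "a \<bullet>\<bullet> b \<in> units"
    using mul_in[OF ab(1)] unit_of_fst by blast
  then show "b = iv a"
    using mul_unitD ab(1) by blast
  show "a' = a" if "n a' \<noteq> 0" "src a' = src a"
  proof (rule src_fst_eqD)
    have "a' \<in> S" using that by (simp add: S_def x_def)
    then show "a' \<in> Ar" "fst a' = fst a"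
      using SA pq \<open>fst a = p\<close> by auto
  qed (use aA that in auto)
  show "b' = b" if "n' b' \<noteq> 0" "rng b' = rng b"
  proof (rule rng_fst_eqD)
    have "b' \<in> T" using that aA by (simp add: T_def)
    then show "b' \<in> Ar" "fst b' = fst b"
      using SA pq \<open>fst b = q\<close> by auto
  qed (use aA that in auto)
qed

section \<open>Explicit form of the normalizers\<close>

definition bisection_pair :: "('a \<times> 'c \<Rightarrow> 'r::comm_ring_1) \<Rightarrow> ('a \<times> 'c \<Rightarrow> 'r) \<Rightarrow> bool"
  where "bisection_pair n n' \<longleftrightarrow> n \<in> Lc (arrows \<G>) \<and> n' \<in> Lc (arrows \<G>) \<and>
    inj_on rng (supp n) \<and> inj_on src (supp n) \<and> supp n' = iv ` supp n \<and>
    (\<forall>a\<in>supp n. n a * n' (iv a) = 1)"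

lemma bisection_pair_bisection: "bisection_pair n n' \<Longrightarrow> supp n \<in> bisections"
  by (auto simp: bisection_pair_def bisections_def Lc_supp_open Lc_supp)

lemma bisection_pair_sym:
  assumes "bisection_pair n n'" shows "bisection_pair n' n"
proof -
  have nA: "supp n \<subseteq> Ar"
    using assms Lc_supp(2) by (auto simp: bisection_pair_def)
  have "iv ` supp n' = supp n"
  proof -
    have "iv ` iv ` supp n = (\<lambda>a. a) ` supp n"
      unfolding image_image using nA iv_iv by (intro image_cong) auto
    then show ?thesis
      using assms by (simp add: bisection_pair_def)
  qed
  moreover have "inj_on rng (iv ` supp n)" "inj_on src (iv ` supp n)"
    using assms nA by (auto simp: bisection_pair_def inj_on_def src_iv rng_iv subset_iff)
  moreover have "\<forall>b\<in>iv ` supp n. n' b * n (iv b) = 1"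
    using assms nA by (auto simp: bisection_pair_def iv_iv subset_iff mult.commute)
  ultimately show ?thesis
    using assms by (simp add: bisection_pair_def)
qed

text \<open>The equation n n' n = n factors an arrow \<open>a\<close> of \<open>supp n\<close> into
  \<open>c\<close>, \<open>d\<close>, \<open>e\<close> with \<open>c\<close>, \<open>e\<close> in
  \<open>supp n\<close> and \<open>d\<close> in \<open>supp n'\<close>. The sandwich with
  \<open>n\<close> on the left gives \<open>d = iv c\<close>, which makes the product of
  \<open>c\<close> and \<open>d\<close> a unit and \<open>e = a\<close>. The sandwich with
  \<open>n'\<close> on the left gives \<open>e = iv d\<close>, so \<open>a = c\<close>. Hence within
  \<open>supp n\<close> no other arrow shares the source or the range of \<open>a\<close>.\<close>

lemma normalizer_bisection_pair:
  fixes n n' :: "'a \<times> 'c \<Rightarrow> 'r::idom"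
  assumes ind: "indicable_throughout G" and nn: "normalizer_pair \<G> n n'"
  shows "bisection_pair n n'"
proof -
  have key: "m' (iv a) \<noteq> 0 \<and> (\<forall>b. m b \<noteq> 0 \<and> src b = src a \<longrightarrow> b = a) \<and> (\<forall>b. m b \<noteq> 0 \<and> rng b = rng a \<longrightarrow> b = a)"
    if mm: "normalizer_pair \<G> m m'" and a: "m a \<noteq> 0" for m m' :: "'a \<times> 'c \<Rightarrow> 'r" and a
  proof -
    have m: "m \<in> Lc (arrows \<G>)" "m' \<in> Lc (arrows \<G>)" "convolution \<G> (convolution \<G> m m') m = m"
      using mm by (auto simp: normalizer_pair_def)
    then obtain u e where ue: "cmp u e" "u \<bullet>\<bullet> e = a" "convolution \<G> m m' u \<noteq> 0" "m e \<noteq> 0"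
      using a convolution_nonzeroD by metis
    then obtain c d where cd: "cmp c d" "c \<bullet>\<bullet> d = u" "m c \<noteq> 0" "m' d \<noteq> 0"
      using convolution_nonzeroD by metis
    have d: "d = iv c"
      by (rule diagonal_sandwich_fibre(1)[OF ind m(1,2) _ cd(1,3,4)])
        (use mm in \<open>auto simp: normalizer_pair_def\<close>)
    have cA: "c \<in> Ar" "e \<in> Ar" using cd(1) ue(1) by (auto simp: comp_iff)
    have u: "u = rng c" "u \<in> units"
      using cd(2) d comp_iv(2)[of c] rng_units[OF cA(1)] by simp_all
    then have ea: "e = a" "rng a = u"
      using unit_left[OF ue(1)] ue(2) by auto
    have de: "cmp d e"
      using cA d u ea by (auto simp: comp_iff iv_in src_iv)
    have diag': "convolution \<G> (convolution \<G> m' f) m \<in> steinberg_diagonal \<G>" if "f \<in> steinberg_diagonal \<G>" for f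
      using mm that by (auto simp: normalizer_pair_def)
    have diag: "convolution \<G> (convolution \<G> m f) m' \<in> steinberg_diagonal \<G>" if "f \<in> steinberg_diagonal \<G>" for f
      using mm that by (auto simp: normalizer_pair_def)
    have "e = iv d"
      by (rule diagonal_sandwich_fibre(1)[OF ind m(2,1) diag' de cd(4) ue(4)])
    then have "a = c"
      using d ea cA iv_iv by simp
    have "b = a" if "m b \<noteq> 0" "src b = src a" for b
      using diagonal_sandwich_fibre(2)[OF ind m(1,2) diag cd(1,3,4), of b] that \<open>a = c\<close> by blast
    moreover have "b = a" if "m b \<noteq> 0" "rng b = rng a" for b
      using diagonal_sandwich_fibre(3)[OF ind m(2,1) diag' de cd(4) ue(4), of b] that ea by blast
    ultimately show ?thesis
      using cd(4) d \<open>a = c\<close> by blast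
  qed
  note nn' = normalizer_pair_sym[OF nn]
  have n: "n \<in> Lc (arrows \<G>)" "n' \<in> Lc (arrows \<G>)" "convolution \<G> (convolution \<G> n n') n = n"
    using nn by (auto simp: normalizer_pair_def)
  have inj: "inj_on rng (supp n)" "inj_on src (supp n)"
    using key[OF nn] by (auto simp: inj_on_def in_supp)
  have "supp n' = iv ` supp n"
  proof
    show "iv ` supp n \<subseteq> supp n'"
      using key[OF nn] by (auto simp: in_supp)
    show "supp n' \<subseteq> iv ` supp n"
    proof
      fix b assume "b \<in> supp n'"
      then have "n (iv b) \<noteq> 0" "b \<in> Ar"
        using key[OF nn'] Lc_in_Ar[OF n(2)] by (auto simp: in_supp)
      then show "b \<in> iv ` supp n"
        using iv_iv by (metis imageI in_supp)
    qed
  qed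
  moreover have "n a * n' (iv a) = 1" if "a \<in> supp n" for a
  proof -
    have a: "n a \<noteq> 0" "a \<in> Ar"
      using that Lc_in_Ar[OF n(1), of a] by (auto simp: in_supp)
    \<comment> \<open>Evaluated at \<open>rng a \<bullet>\<bullet> a\<close>, the triple product has
      a single term, and \<open>n a\<close> is cancelled from both sides.\<close>
    have "n a = convolution \<G> (convolution \<G> n n') n (rng a \<bullet>\<bullet> a)"
      using n(3) comp_rng(2)[OF a(2)] by simp
    also have "\<dots> = convolution \<G> n n' (a \<bullet>\<bullet> iv a) * n a"
      by (subst convolution_right[OF inj(2) comp_rng(1)[OF a(2)] a(1)]) (simp add: comp_iv(2))
    also have "\<dots> = (n a * n' (iv a)) * n a"
      by (subst convolution_left[OF inj(1) comp_iv(1)[OF a(2)] a(1)]) simp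
    finally show ?thesis
      using a(1) by simp
  qed
  ultimately show ?thesis
    using n inj by (simp add: bisection_pair_def)
qed

text \<open>From left to right: a composable pair from \<open>supp n\<close> and
  \<open>supp m'\<close> consists of an arrow and its own inverse, since both come from the
  bisection \<open>supp m\<close>; then \<open>m c * m' (iv c) = 1\<close> restores
  \<open>n\<close>. From right to left: multiplying \<open>m\<close> by a diagonal element cannot
  enlarge its support.\<close>

lemma supp_subset_iff:
  fixes n m m' :: "'a \<times> 'c \<Rightarrow> 'r::comm_ring_1"
  assumes n: "n \<in> Lc (arrows \<G>)" and mm: "bisection_pair m m'"
  shows "supp n \<subseteq> supp m \<longleftrightarrow>
    convolution \<G> n m' \<in> steinberg_diagonal \<G> \<and> convolution \<G> (convolution \<G> n m') m = n"
proof
  assume R: "convolution \<G> n m' \<in> steinberg_diagonal \<G> \<and> convolution \<G> (convolution \<G> n m') m = n"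
  show "supp n \<subseteq> supp m"
  proof
    fix a assume "a \<in> supp n"
    then have "convolution \<G> (convolution \<G> n m') m a \<noteq> 0"
      using R by (simp add: in_supp)
    then obtain u e where ue: "cmp u e" "u \<bullet>\<bullet> e = a" "convolution \<G> n m' u \<noteq> 0" "m e \<noteq> 0"
      by (rule convolution_nonzeroE)
    then have "u \<in> units"
      using R by (auto simp: diagonal_iff supp_def)
    then show "a \<in> supp m"
      using unit_left[OF ue(1)] ue by (auto simp: in_supp)
  qed
next
  assume sub: "supp n \<subseteq> supp m"
  have m: "m \<in> Lc (arrows \<G>)" "m' \<in> Lc (arrows \<G>)" "inj_on src (supp m)" "inj_on src (supp m')"
    "supp m' = iv ` supp m" "\<And>a. a \<in> supp m \<Longrightarrow> m a * m' (iv a) = 1"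
    using mm bisection_pair_sym[OF mm] by (simp_all add: bisection_pair_def)
  have mA: "supp m \<subseteq> Ar"
    by (rule Lc_supp[OF m(1)])
  have nm: "convolution \<G> n m' \<in> steinberg_diagonal \<G>"
    unfolding diagonal_iff
  proof
    show "convolution \<G> n m' \<in> Lc (arrows \<G>)"
      using n m by (simp add: Lc_convolution)
    show "supp (convolution \<G> n m') \<subseteq> units"
    proof
      fix c assume "c \<in> supp (convolution \<G> n m')"
      then obtain a b where ab: "cmp a b" "a \<bullet>\<bullet> b = c" "n a \<noteq> 0" "m' b \<noteq> 0"
        using convolution_nonzeroD[of \<G> n m' c] by (auto simp: in_supp)
      have "b \<in> iv ` supp m"
        using ab(4) m(5) by (metis in_supp)
      then obtain e where e: "e \<in> supp m" "b = iv e"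
        by blast
      have eA: "e \<in> Ar" "a \<in> Ar"
        using e mA ab(1) by (auto simp: comp_iff)
      have "src a = src e"
        using ab(1) e eA by (auto simp: comp_iff rng_iv)
      then have "a = e"
        using inj_onD[OF m(3)] subsetD[OF sub] e ab(3) by (simp add: in_supp)
      then show "c \<in> units"
        using ab e eA comp_iv(2) rng_units by metis
    qed
  qed
  moreover have "convolution \<G> (convolution \<G> n m') m c = n c" for c
  proof (cases "c \<in> supp m")
    case True
    have "iv c \<in> supp m'"
      using True m(5) by blast
    then have c: "m c \<noteq> 0" "m' (iv c) \<noteq> 0" "c \<in> Ar" "m c * m' (iv c) = 1"
      using True m(6)[OF True] mA by (auto simp: in_supp)
    have "convolution \<G> (convolution \<G> n m') m c = convolution \<G> (convolution \<G> n m') m (rng c \<bullet>\<bullet> c)"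
      using comp_rng(2)[OF c(3)] by simp
    also have "\<dots> = convolution \<G> n m' (c \<bullet>\<bullet> iv c) * m c"
      by (subst convolution_right[OF m(3) comp_rng(1)[OF c(3)] c(1)]) (simp add: comp_iv(2))
    also have "\<dots> = n c * (m c * m' (iv c))"
      by (subst convolution_right[OF m(4) comp_iv(1)[OF c(3)] c(2)]) (simp add: mult.commute mult.left_commute)
    finally show ?thesis
      using c by simp
  next
    case False
    then have "n c = 0"
      using sub by (auto simp: in_supp)
    moreover have "convolution \<G> (convolution \<G> n m') m c = 0"
    proof (rule ccontr)
      assume "convolution \<G> (convolution \<G> n m') m c \<noteq> 0"
      then obtain u e where ue: "cmp u e" "u \<bullet>\<bullet> e = c" "convolution \<G> n m' u \<noteq> 0" "m e \<noteq> 0"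
        by (rule convolution_nonzeroE)
      then have "u \<in> units"
        using nm by (auto simp: diagonal_iff supp_def)
      then show False
        using unit_left[OF ue(1)] ue False by (auto simp: in_supp)
    qed
    ultimately show ?thesis by simp
  qed
  ultimately show "convolution \<G> n m' \<in> steinberg_diagonal \<G> \<and> convolution \<G> (convolution \<G> n m') m = n"
    by blast
qed

text \<open>The product of \<open>n\<close> and \<open>d\<close> has its support inside
  \<open>supp n\<close>, so the inclusion criterion already says that multiplying it by
  \<open>n'\<close> gives a diagonal element.\<close>

lemma bisection_pair_diagonal:
  fixes n n' d :: "'a \<times> 'c \<Rightarrow> 'r::comm_ring_1"
  assumes nn: "bisection_pair n n'" and d: "d \<in> steinberg_diagonal \<G>"
  shows "convolution \<G> (convolution \<G> n d) n' \<in> steinberg_diagonal \<G>"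
proof -
  have n: "n \<in> Lc (arrows \<G>)"
    using nn by (simp add: bisection_pair_def)
  have nd: "convolution \<G> n d \<in> Lc (arrows \<G>)"
    using n d by (simp add: Lc_convolution diagonal_iff)
  have "supp (convolution \<G> n d) \<subseteq> supp n"
  proof
    fix e assume "e \<in> supp (convolution \<G> n d)"
    then show "e \<in> supp n"
      using convolution_diagonal[OF d, of e n] Lc_in_Ar[OF nd, of e] by (auto simp: in_supp)
  qed
  then show ?thesis
    using supp_subset_iff[OF nd nn] by blast
qed

lemma bisection_normalizer_pair:
  fixes n n' :: "'a \<times> 'c \<Rightarrow> 'r::comm_ring_1"
  assumes nn: "bisection_pair n n'"
  shows "normalizer_pair \<G> n n'"
proof -
  note nn' = bisection_pair_sym[OF nn]
  have n: "n \<in> Lc (arrows \<G>)" "n' \<in> Lc (arrows \<G>)"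
    using nn by (auto simp: bisection_pair_def)
  show ?thesis
    unfolding normalizer_pair_def
    using n bisection_pair_diagonal[OF nn] bisection_pair_diagonal[OF nn']
      supp_subset_iff[OF n(1) nn] supp_subset_iff[OF n(2) nn'] by blast
qed

lemma char_fun_bisection_pair:
  assumes B: "B \<in> bisections"
  shows "bisection_pair (char_fun B :: _ \<Rightarrow> 'r::comm_ring_1) (char_fun (iv ` B))"
  unfolding bisection_pair_def supp_char_fun
  using B Lc_char_fun[OF B] Lc_char_fun[OF bisection_iv[OF B]]
  by (simp add: bisections_def char_fun_def)

section \<open>Products of bisections\<close>

definition bis_mult :: "('a \<times> 'c) set \<Rightarrow> ('a \<times> 'c) set \<Rightarrow> ('a \<times> 'c) set"
  where "bis_mult B C = {a \<bullet>\<bullet> b | a b. a \<in> B \<and> b \<in> C \<and> cmp a b}"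

lemma bis_multI:
  "a \<in> B \<Longrightarrow> b \<in> C \<Longrightarrow> cmp a b \<Longrightarrow> a \<bullet>\<bullet> b \<in> bis_mult B C"
  unfolding bis_mult_def by blast

lemma convolution_char_fun:
  assumes B: "B \<in> bisections"
  shows "convolution \<G> (char_fun B) (char_fun C) = (char_fun (bis_mult B C) :: _ \<Rightarrow> 'r::comm_ring_1)"
proof
  fix c
  show "convolution \<G> (char_fun B) (char_fun C) c = (char_fun (bis_mult B C) c :: 'r)"
  proof (cases "c \<in> bis_mult B C")
    case True
    then obtain a b where ab: "a \<in> B" "b \<in> C" "cmp a b" "c = a \<bullet>\<bullet> b"
      by (auto simp: bis_mult_def)
    have "convolution \<G> (char_fun B) (char_fun C) (a \<bullet>\<bullet> b) = (char_fun B a * char_fun C b :: 'r)"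
    proof (rule convolution_left)
      show "inj_on rng (supp (char_fun B :: _ \<Rightarrow> 'r))" "(char_fun B a :: 'r) \<noteq> 0"
        using B ab by (simp_all add: bisections_def) (simp add: char_fun_def)
    qed (rule ab)
    then show ?thesis
      using ab True by (simp add: char_fun_def)
  next
    case False
    then have "\<not> (\<exists>a b. cmp a b \<and> a \<bullet>\<bullet> b = c \<and> (char_fun B a :: 'r) \<noteq> 0 \<and> (char_fun C b :: 'r) \<noteq> 0)"
      by (auto simp: bis_mult_def char_fun_def split: if_splits)
    then have "convolution \<G> (char_fun B) (char_fun C) c = (0 :: 'r)"
      by (metis convolution_nonzeroD)
    then show ?thesis
      using False by (simp add: char_fun_def)
  qed
qed

text \<open>Openness and compactness are obtained without studying the composition map: the product
  is the support of a convolution of indicators, and convolutions stay in \<open>Lc\<close>. The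
  coefficient ring is free to choose here; \<open>int\<close> is taken.\<close>

lemma bisection_mult:
  assumes B: "B \<in> bisections" and C: "C \<in> bisections"
  shows "bis_mult B C \<in> bisections"
proof -
  have "(char_fun (bis_mult B C) :: _ \<Rightarrow> int) \<in> Lc (arrows \<G>)"
    using Lc_convolution[OF Lc_char_fun[OF B] Lc_char_fun[OF C]] by (simp add: convolution_char_fun[OF B])
  then have "openin (arrows \<G>) (bis_mult B C)" "compactin (arrows \<G>) (bis_mult B C)"
    using Lc_supp_open Lc_supp(1) by (metis supp_char_fun)+
  moreover have "a = a' \<and> b = b'"
    if "a \<in> B" "b \<in> C" "cmp a b" "a' \<in> B" "b' \<in> C" "cmp a' b'" "rng (a \<bullet>\<bullet> b) = rng (a' \<bullet>\<bullet> b')" for a b a' b'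
  proof -
    have "a = a'"
      using that B by (auto simp: rng_mul bisections_def inj_on_def)
    then show ?thesis
      using that C by (auto simp: comp_iff bisections_def inj_on_def)
  qed
  moreover have "a = a' \<and> b = b'"
    if "a \<in> B" "b \<in> C" "cmp a b" "a' \<in> B" "b' \<in> C" "cmp a' b'" "src (a \<bullet>\<bullet> b) = src (a' \<bullet>\<bullet> b')" for a b a' b'
  proof -
    have "b = b'"
      using that C by (auto simp: src_mul bisections_def inj_on_def)
    then show ?thesis
      using that B by (auto simp: comp_iff bisections_def inj_on_def)
  qed
  ultimately show ?thesis
    unfolding bisections_def bis_mult_def inj_on_def by blast
qed

end

section \<open>Homeomorphisms from isomorphisms of compact open bases\<close>

definition compact_open_ring_base :: "'m topology \<Rightarrow> 'm set set \<Rightarrow> bool"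
  where "compact_open_ring_base S \<B> \<longleftrightarrow>
    (\<forall>B\<in>\<B>. openin S B \<and> compactin S B) \<and>
    (\<forall>U x. openin S U \<and> x \<in> U \<longrightarrow> (\<exists>B\<in>\<B>. x \<in> B \<and> B \<subseteq> U)) \<and>
    (\<forall>B\<in>\<B>. \<forall>C\<in>\<B>. B \<inter> C \<in> \<B> \<and> B - C \<in> \<B>)"

lemma compact_open_ring_baseE:
  assumes "compact_open_ring_base S \<B>" "openin S U" "x \<in> U"
  obtains B where "B \<in> \<B>" "x \<in> B" "B \<subseteq> U"
proof -
  have "\<exists>B\<in>\<B>. x \<in> B \<and> B \<subseteq> U"
    using assms by (simp add: compact_open_ring_base_def)
  then show thesis
    using that by blast
qed

lemma base_separates:
  assumes "Hausdorff_space S" "compact_open_ring_base S \<B>" "a \<in> topspace S" "a' \<in> topspace S"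
    and sub: "\<And>B. B \<in> \<B> \<Longrightarrow> a \<in> B \<Longrightarrow> a' \<in> B"
  shows "a' = a"
proof (rule ccontr)
  assume "a' \<noteq> a"
  then obtain U U' where U: "openin S U" "openin S U'" "a \<in> U" "a' \<in> U'" "disjnt U U'"
    using assms(1,3,4) unfolding Hausdorff_space_def by metis
  then obtain B where "B \<in> \<B>" "a \<in> B" "B \<subseteq> U"
    using compact_open_ring_baseE[OF assms(2)] by metis
  then show False
    using sub U by (auto simp: disjnt_iff)
qed

text \<open>The sets \<open>L B\<close> with \<open>a \<in> B\<close> are nonempty, compact and
  closed under finite intersections, so they have a common point. Two such points would be separated
  by some \<open>L K\<close>, and either \<open>K\<close> or a difference \<open>B0 - K\<close>
  contains \<open>a\<close>.\<close>

lemma base_iso_point: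
  assumes T: "Hausdorff_space T"
    and bases: "compact_open_ring_base S \<B>" "compact_open_ring_base T \<C>"
    and L: "L ` \<B> = \<C>" and order: "\<And>B C. B \<in> \<B> \<Longrightarrow> C \<in> \<B> \<Longrightarrow> L B \<subseteq> L C \<longleftrightarrow> B \<subseteq> C"
    and a: "a \<in> topspace S"
  shows "\<exists>!b. b \<in> topspace T \<and> (\<forall>B\<in>\<B>. a \<in> B \<longrightarrow> b \<in> L B)"
proof -
  have ring: "B \<inter> C \<in> \<B>" "B - C \<in> \<B>" if "B \<in> \<B>" "C \<in> \<B>" for B C
    using bases(1) that by (auto simp: compact_open_ring_base_def)
  have LC: "L B \<in> \<C>" "openin T (L B)" "compactin T (L B)" "closedin T (L B)" if "B \<in> \<B>" for B
    using bases(2) L that compactin_imp_closedin[OF T] by (auto simp: compact_open_ring_base_def)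
  have L_Int: "L (B \<inter> C) = L B \<inter> L C" if BC: "B \<in> \<B>" "C \<in> \<B>" for B C
  proof
    show "L (B \<inter> C) \<subseteq> L B \<inter> L C"
      using order BC ring by simp
    \<comment> \<open>The intersection lies in \<open>\<C>\<close>, so it is \<open>L K\<close> for
      some \<open>K\<close>; the order then forces
      \<open>K \<subseteq> B \<inter> C\<close>.\<close>
    have "L B \<inter> L C \<in> \<C>"
      using bases(2) LC(1) BC by (simp add: compact_open_ring_base_def)
    then obtain K where K: "K \<in> \<B>" "L K = L B \<inter> L C"
      using L by (metis imageE)
    then have "K \<subseteq> B" "K \<subseteq> C"
      using order[of K B] order[of K C] BC by auto
    then show "L B \<inter> L C \<subseteq> L (B \<inter> C)"
      using K order[of K "B \<inter> C"] ring BC by simp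
  qed
  obtain B0 where B0: "B0 \<in> \<B>" "a \<in> B0"
    using compact_open_ring_baseE[OF bases(1) openin_topspace a] by metis
  have empty: "{} \<in> \<B>" "L {} = {}"
  proof -
    show "{} \<in> \<B>"
      using ring(2)[OF B0(1) B0(1)] by simp
    have "L B0 - L B0 \<in> \<C>"
      using bases(2) LC(1)[OF B0(1)] unfolding compact_open_ring_base_def by blast
    then obtain K where "K \<in> \<B>" "L K = {}"
      using L by auto
    then show "L {} = {}"
      using order[of "{}" K] \<open>{} \<in> \<B>\<close> by simp
  qed
  let ?F = "L ` {B \<in> \<B>. a \<in> B}"
  have "L B0 \<inter> \<Inter> ?F \<noteq> {}"
  proof -
    have "L B0 \<inter> \<Inter> \<D> \<noteq> {}" if "finite \<D>" "\<D> \<subseteq> ?F" for \<D>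
    proof -
      have "\<exists>B\<in>\<B>. a \<in> B \<and> L B \<subseteq> L B0 \<inter> \<Inter> \<D>"
        using that
      proof (induction \<D>)
        case empty
        then show ?case using B0 by auto
      next
        case (insert E \<D>)
        then obtain B where B: "B \<in> \<B>" "a \<in> B" "L B \<subseteq> L B0 \<inter> \<Inter> \<D>"
          by auto
        obtain C where C: "C \<in> \<B>" "a \<in> C" "E = L C"
          using insert.prems by auto
        show ?case
          using B C L_Int ring(1) by (intro bexI[of _ "B \<inter> C"]) auto
      qed
      then obtain B where "B \<in> \<B>" "a \<in> B" "L B \<subseteq> L B0 \<inter> \<Inter> \<D>"
        by blast
      moreover from this have "L B \<noteq> {}"
        using order[of B "{}"] empty by auto
      ultimately show ?thesis by blast
    qed
    moreover have "\<forall>C\<in>?F. closedin T C"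
      using LC(4) by auto
    ultimately show ?thesis
      using LC(3)[OF B0(1)] unfolding compactin_fip by blast
  qed
  then obtain b where b: "b \<in> L B0" "\<forall>B\<in>\<B>. a \<in> B \<longrightarrow> b \<in> L B"
    by auto
  have bT: "b \<in> topspace T"
    using b(1) LC(2)[OF B0(1)] openin_subset by blast
  have uniq: "b' = b" if b': "b' \<in> topspace T" "\<forall>B\<in>\<B>. a \<in> B \<longrightarrow> b' \<in> L B" for b'
  proof (rule ccontr)
    assume "b' \<noteq> b"
    then obtain U U' where U: "openin T U" "openin T U'" "b \<in> U" "b' \<in> U'" "disjnt U U'"
      using T bT b'(1) unfolding Hausdorff_space_def by metis
    obtain C where "C \<in> \<C>" "b \<in> C" "C \<subseteq> U"
      using compact_open_ring_baseE[OF bases(2) U(1,3)] by metis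
    then obtain K where K: "K \<in> \<B>" "b \<in> L K" "L K \<subseteq> U"
      using L by auto
    show False
    proof (cases "a \<in> K")
      case True
      then show False
        using b'(2) K U by (auto simp: disjnt_def)
    next
      case False
      \<comment> \<open>Here \<open>B0 - K\<close> is a neighbourhood of \<open>a\<close>, and its
        image is disjoint from \<open>L K\<close> because \<open>L\<close> preserves intersections
        and the empty set.\<close>
      then have "b \<in> L (B0 - K)"
        using b(2) B0 ring(2)[OF B0(1) K(1)] by simp
      moreover have "L (B0 - K) \<inter> L K = {}"
        using L_Int[OF ring(2)[OF B0(1) K(1)] K(1)] empty(2) by (simp add: Int_Diff Diff_Int_distrib2 inf_commute)
      ultimately show False
        using K(2) by blast
    qed
  qed
  show ?thesis
  proof (rule ex1I[of _ b])
    show "b \<in> topspace T \<and> (\<forall>B\<in>\<B>. a \<in> B \<longrightarrow> b \<in> L B)"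
      using bT b(2) by blast
  qed (rule uniq, (erule conjunct1 conjunct2)+)
qed

text \<open>The inverse map comes from the same construction for the inverse order isomorphism
  \<open>M\<close>. Continuity can be read off the bases, since \<open>\<phi> a \<in> C\<close> for
  every \<open>a \<in> M C\<close>. The last property singles out \<open>\<phi> a\<close> among the
  points of the target; ranges and sources of images are identified through it.\<close>

lemma base_iso_homeomorphism:
  assumes S: "Hausdorff_space S" and T: "Hausdorff_space T"
    and bases: "compact_open_ring_base S \<B>" "compact_open_ring_base T \<C>"
    and L: "L ` \<B> = \<C>" and order: "\<And>B C. B \<in> \<B> \<Longrightarrow> C \<in> \<B> \<Longrightarrow> L B \<subseteq> L C \<longleftrightarrow> B \<subseteq> C"
  obtains \<phi> where "homeomorphic_map S T \<phi>"
      "\<And>a B. a \<in> B \<Longrightarrow> B \<in> \<B> \<Longrightarrow> \<phi> a \<in> L B"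
      "\<And>a b. a \<in> topspace S \<Longrightarrow> b \<in> topspace T \<Longrightarrow> (\<And>B. B \<in> \<B> \<Longrightarrow> a \<in> B \<Longrightarrow> b \<in> L B) \<Longrightarrow> b = \<phi> a"
proof -
  have inj: "inj_on L \<B>"
    using order by (auto intro!: inj_onI)
  define M where "M = inv_into \<B> L"
  have M_L: "M (L B) = B" if "B \<in> \<B>" for B
    using inj that by (simp add: M_def)
  have M: "M ` \<C> = \<B>"
    using M_L L by (auto simp: image_iff)
  have orderM: "M B \<subseteq> M C \<longleftrightarrow> B \<subseteq> C" if "B \<in> \<C>" "C \<in> \<C>" for B C
  proof -
    have "B \<in> L ` \<B>" "C \<in> L ` \<B>"
      using that L by simp_all
    then obtain B' C' where BC': "B' \<in> \<B>" "B = L B'" "C' \<in> \<B>" "C = L C'"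
      by (elim imageE)
    then show ?thesis
      using order[OF BC'(1,3)] M_L by simp
  qed
  define \<phi> where "\<phi> a = (THE b. b \<in> topspace T \<and> (\<forall>B\<in>\<B>. a \<in> B \<longrightarrow> b \<in> L B))" for a
  define \<psi> where "\<psi> b = (THE a. a \<in> topspace S \<and> (\<forall>C\<in>\<C>. b \<in> C \<longrightarrow> a \<in> M C))" for b
  note uniq1 = base_iso_point[OF T bases L order]
  note uniq2 = base_iso_point[OF S bases(2,1) M orderM]
  have \<phi>: "\<phi> a \<in> topspace T \<and> (\<forall>B\<in>\<B>. a \<in> B \<longrightarrow> \<phi> a \<in> L B)" if "a \<in> topspace S" for a
    unfolding \<phi>_def by (rule theI'[OF uniq1]) (use that in auto)
  have \<psi>: "\<psi> b \<in> topspace S \<and> (\<forall>C\<in>\<C>. b \<in> C \<longrightarrow> \<psi> b \<in> M C)" if "b \<in> topspace T" for b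
    unfolding \<psi>_def by (rule theI'[OF uniq2]) (use that in auto)
  have LC: "L B \<in> \<C>" if "B \<in> \<B>" for B
    using L that by blast
  have MB: "M C \<in> \<B>" "L (M C) = C" if "C \<in> \<C>" for C
    using that M L f_inv_into_f[of C L \<B>] by (auto simp: M_def)
  have \<psi>\<phi>: "\<psi> (\<phi> a) = a" if "a \<in> topspace S" for a
  proof (rule base_separates[OF S bases(1) that])
    show "\<psi> (\<phi> a) \<in> topspace S"
      using \<phi> \<psi> that by blast
    show "\<psi> (\<phi> a) \<in> B" if "B \<in> \<B>" "a \<in> B" for B
      using \<phi>[OF \<open>a \<in> topspace S\<close>] \<psi>[of "\<phi> a"] that LC M_L by metis
  qed
  have \<phi>\<psi>: "\<phi> (\<psi> b) = b" if "b \<in> topspace T" for b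
  proof (rule base_separates[OF T bases(2) that])
    show "\<phi> (\<psi> b) \<in> topspace T"
      using \<phi> \<psi> that by blast
    show "\<phi> (\<psi> b) \<in> C" if "C \<in> \<C>" "b \<in> C" for C
      using \<psi>[OF \<open>b \<in> topspace T\<close>] \<phi>[of "\<psi> b"] that MB by metis
  qed
  have "continuous_map S T \<phi>"
    unfolding continuous_map
  proof (intro conjI allI impI)
    show "\<phi> ` topspace S \<subseteq> topspace T" using \<phi> by auto
    fix U assume U: "openin T U"
    show "openin S {a \<in> topspace S. \<phi> a \<in> U}"
    proof (subst openin_subopen, clarify)
      fix a assume a: "a \<in> topspace S" "\<phi> a \<in> U"
      then obtain C where C: "C \<in> \<C>" "\<phi> a \<in> C" "C \<subseteq> U"
        using compact_open_ring_baseE[OF bases(2) U] by metis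
      have "openin S (M C)"
        using MB C bases(1) by (auto simp: compact_open_ring_base_def)
      moreover have "a \<in> M C"
        using \<psi>[of "\<phi> a"] \<phi> \<psi>\<phi> a C by metis
      moreover have "M C \<subseteq> {a \<in> topspace S. \<phi> a \<in> U}"
        using openin_subset[OF \<open>openin S (M C)\<close>] \<phi> MB[OF C(1)] C(3) by blast
      ultimately show "\<exists>V. openin S V \<and> a \<in> V \<and> V \<subseteq> {a \<in> topspace S. \<phi> a \<in> U}"
        by blast
    qed
  qed
  moreover have "continuous_map T S \<psi>"
    unfolding continuous_map
  proof (intro conjI allI impI)
    show "\<psi> ` topspace T \<subseteq> topspace S" using \<psi> by auto
    fix U assume U: "openin S U"
    show "openin T {b \<in> topspace T. \<psi> b \<in> U}"
    proof (subst openin_subopen, clarify)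
      fix b assume b: "b \<in> topspace T" "\<psi> b \<in> U"
      then obtain B where B: "B \<in> \<B>" "\<psi> b \<in> B" "B \<subseteq> U"
        using compact_open_ring_baseE[OF bases(1) U] by metis
      have "openin T (L B)"
        using LC B bases(2) by (auto simp: compact_open_ring_base_def)
      moreover have "b \<in> L B"
        using \<phi>[of "\<psi> b"] \<psi> \<phi>\<psi> b B by metis
      moreover have "L B \<subseteq> {b \<in> topspace T. \<psi> b \<in> U}"
        using openin_subset[OF \<open>openin T (L B)\<close>] \<psi> LC[OF B(1)] M_L[OF B(1)] B(3) by blast
      ultimately show "\<exists>V. openin T V \<and> b \<in> V \<and> V \<subseteq> {b \<in> topspace T. \<psi> b \<in> U}"
        by blast
    qed
  qed
  ultimately have "homeomorphic_maps S T \<phi> \<psi>"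
    using \<psi>\<phi> \<phi>\<psi> by (simp add: homeomorphic_maps_def)
  then have "homeomorphic_map S T \<phi>"
    using homeomorphic_map_maps by blast
  moreover have "\<phi> a \<in> L B" if "a \<in> B" "B \<in> \<B>" for a B
  proof -
    have "openin S B"
      using bases(1) that(2) by (simp add: compact_open_ring_base_def)
    then have "a \<in> topspace S"
      using that(1) openin_subset by blast
    then show ?thesis
      using \<phi> that by blast
  qed
  moreover have "b = \<phi> a" if "a \<in> topspace S" "b \<in> topspace T" "\<And>B. B \<in> \<B> \<Longrightarrow> a \<in> B \<Longrightarrow> b \<in> L B" for a b
    using uniq1[OF _ _ that(1)] \<phi>[OF that(1)] that by metis
  ultimately show thesis
    using that by blast
qed

section \<open>Reconstruction of the groupoid\<close>

text \<open>\<open>algebra_iso\<close> does not contain closure of the carrier under the operations,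
  so closure is supplied separately: it allows the inverse map to be cancelled against
  \<open>\<phi>\<close> at a sum, a product or a multiple.\<close>

lemma algebra_iso_inverse:
  assumes iso: "algebra_iso A B \<phi>"
    and add: "\<And>a b. a \<in> alg_carrier A \<Longrightarrow> b \<in> alg_carrier A \<Longrightarrow> alg_add A a b \<in> alg_carrier A"
    and mult: "\<And>a b. a \<in> alg_carrier A \<Longrightarrow> b \<in> alg_carrier A \<Longrightarrow> alg_mult A a b \<in> alg_carrier A"
    and scale: "\<And>r a. a \<in> alg_carrier A \<Longrightarrow> alg_scale A r a \<in> alg_carrier A"
  shows "algebra_iso B A (inv_into (alg_carrier A) \<phi>)"
proof -
  let ?\<psi> = "inv_into (alg_carrier A) \<phi>"
  have bij: "bij_betw \<phi> (alg_carrier A) (alg_carrier B)"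
    using iso by (simp add: algebra_iso_def)
  have \<psi>: "?\<psi> b \<in> alg_carrier A" "\<phi> (?\<psi> b) = b" if "b \<in> alg_carrier B" for b
    using bij that by (auto simp: bij_betw_def f_inv_into_f inv_into_into)
  have \<psi>\<phi>: "?\<psi> (\<phi> a) = a" if "a \<in> alg_carrier A" for a
    using bij that by (auto simp: bij_betw_def)
  have "?\<psi> (alg_add B b c) = alg_add A (?\<psi> b) (?\<psi> c)" if "b \<in> alg_carrier B" "c \<in> alg_carrier B" for b c
    using \<psi>\<phi>[OF add[OF \<psi>(1)[OF that(1)] \<psi>(1)[OF that(2)]]] iso \<psi> that by (simp add: algebra_iso_def)
  moreover have "?\<psi> (alg_mult B b c) = alg_mult A (?\<psi> b) (?\<psi> c)" if "b \<in> alg_carrier B" "c \<in> alg_carrier B" for b c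
    using \<psi>\<phi>[OF mult[OF \<psi>(1)[OF that(1)] \<psi>(1)[OF that(2)]]] iso \<psi> that by (simp add: algebra_iso_def)
  moreover have "?\<psi> (alg_scale B r b) = alg_scale A r (?\<psi> b)" if "b \<in> alg_carrier B" for r b
    using \<psi>\<phi>[OF scale[OF \<psi>(1)[OF that]]] iso \<psi> that by (simp add: algebra_iso_def)
  ultimately show ?thesis
    using bij_betw_inv_into[OF bij] by (simp add: algebra_iso_def)
qed

lemma algebra_iso_comp:
  assumes "algebra_iso A B \<phi>" "algebra_iso B C \<psi>"
  shows "algebra_iso A C (\<lambda>a. \<psi> (\<phi> a))"
  using assms bij_betw_trans[of \<phi> "alg_carrier A" "alg_carrier B" \<psi> "alg_carrier C"]
  by (auto simp: algebra_iso_def comp_def bij_betwE)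

lemma (in ample_action) bisections_base: "compact_open_ring_base (arrows \<G>) bisections"
  unfolding compact_open_ring_base_def
  using bisection_base bisection_Int bisection_Diff by (auto simp: bisections_def) metis

text \<open>With the isomorphism fixed in a locale, every statement becomes available for its
  inverse by interpreting the locale with the two sides exchanged.\<close>

locale diagonal_iso = A: ample_action G X D \<theta> + B: ample_action H Y E \<gamma>
  for G :: "('g, 'k) monoid_scheme" and X :: "'x topology" and D and \<theta>
    and H :: "('h, 'l) monoid_scheme" and Y :: "'y topology" and E and \<gamma> +
  fixes \<Gamma> :: "('g \<times> 'x \<Rightarrow> 'r::idom) \<Rightarrow> ('h \<times> 'y \<Rightarrow> 'r)"
  assumes ind_G: "indicable_throughout G" and ind_H: "indicable_throughout H"
    and iso: "diagonal_preserving_iso A.\<G> B.\<G> \<Gamma>"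
begin

lemma bij: "bij_betw \<Gamma> (Lc (arrows A.\<G>)) (Lc (arrows B.\<G>))"
  using iso by (simp add: diagonal_preserving_iso_def algebra_iso_def steinberg_algebra_def)

lemma \<Gamma>_in: "f \<in> Lc (arrows A.\<G>) \<Longrightarrow> \<Gamma> f \<in> Lc (arrows B.\<G>)"
  using bij bij_betwE by blast

lemma \<Gamma>_convolution:
  "f \<in> Lc (arrows A.\<G>) \<Longrightarrow> g \<in> Lc (arrows A.\<G>) \<Longrightarrow>
    \<Gamma> (convolution A.\<G> f g) = convolution B.\<G> (\<Gamma> f) (\<Gamma> g)"
  using iso by (simp add: diagonal_preserving_iso_def algebra_iso_def steinberg_algebra_def)

lemma \<Gamma>_diagonal: "\<Gamma> ` steinberg_diagonal A.\<G> = steinberg_diagonal B.\<G>"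
  using iso by (simp add: diagonal_preserving_iso_def)

lemma inverse: "diagonal_iso H Y E \<gamma> G X D \<theta> (inv_into (Lc (arrows A.\<G>)) \<Gamma>)"
proof unfold_locales
  have "algebra_iso (steinberg_algebra B.\<G>) (steinberg_algebra A.\<G>) (inv_into (Lc (arrows A.\<G>)) \<Gamma>)"
    using algebra_iso_inverse[of "steinberg_algebra A.\<G>" "steinberg_algebra B.\<G>" \<Gamma>] iso
    by (simp add: diagonal_preserving_iso_def steinberg_algebra_def Lc_add Lc_scale A.Lc_convolution)
  moreover have "inv_into (Lc (arrows A.\<G>)) \<Gamma> ` steinberg_diagonal B.\<G> = steinberg_diagonal A.\<G>"
  proof -
    have "steinberg_diagonal A.\<G> \<subseteq> Lc (arrows A.\<G>)"
      using diagonal_iff by blast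
    then show ?thesis
      using bij inv_into_image_cancel[of \<Gamma> "Lc (arrows A.\<G>)" "steinberg_diagonal A.\<G>"]
      by (simp add: bij_betw_def \<Gamma>_diagonal)
  qed
  ultimately show "diagonal_preserving_iso B.\<G> A.\<G> (inv_into (Lc (arrows A.\<G>)) \<Gamma>)"
    by (simp add: diagonal_preserving_iso_def)
qed (rule ind_G ind_H)+

text \<open>Each diagonal element of the target is the image of a diagonal element, so each sandwich
  condition there is the image of one at the source.\<close>

lemma \<Gamma>_normalizer_pair:
  assumes "normalizer_pair A.\<G> n n'" shows "normalizer_pair B.\<G> (\<Gamma> n) (\<Gamma> n')"
proof -
  have n: "n \<in> Lc (arrows A.\<G>)" "n' \<in> Lc (arrows A.\<G>)"
    using assms by (auto simp: normalizer_pair_def)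
  have tr: "convolution B.\<G> (convolution B.\<G> (\<Gamma> f) (\<Gamma> g)) (\<Gamma> h) = \<Gamma> (convolution A.\<G> (convolution A.\<G> f g) h)"
    if "f \<in> Lc (arrows A.\<G>)" "g \<in> Lc (arrows A.\<G>)" "h \<in> Lc (arrows A.\<G>)" for f g h
    using that by (simp add: \<Gamma>_convolution A.Lc_convolution)
  have "convolution B.\<G> (convolution B.\<G> (\<Gamma> n) d') (\<Gamma> n') \<in> steinberg_diagonal B.\<G> \<and>
        convolution B.\<G> (convolution B.\<G> (\<Gamma> n') d') (\<Gamma> n) \<in> steinberg_diagonal B.\<G>"
    if d': "d' \<in> steinberg_diagonal B.\<G>" for d'
  proof -
    obtain d where d: "d \<in> steinberg_diagonal A.\<G>" "d' = \<Gamma> d"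
      using d' unfolding \<Gamma>_diagonal[symmetric] by blast
    then have "d \<in> Lc (arrows A.\<G>)"
      by (simp add: diagonal_iff)
    then show ?thesis
      using assms d n \<Gamma>_diagonal by (auto simp: tr normalizer_pair_def)
  qed
  then show ?thesis
    using assms n by (simp add: normalizer_pair_def \<Gamma>_in tr)
qed

lemma \<Gamma>_bisection_pair:
  "A.bisection_pair n n' \<Longrightarrow> B.bisection_pair (\<Gamma> n) (\<Gamma> n')"
  by (intro B.normalizer_bisection_pair[OF ind_H] \<Gamma>_normalizer_pair A.bisection_normalizer_pair)

lemma \<Gamma>_supp_mono:
  assumes n: "n \<in> Lc (arrows A.\<G>)" and m: "A.bisection_pair m m'" and sub: "supp n \<subseteq> supp m"
  shows "supp (\<Gamma> n) \<subseteq> supp (\<Gamma> m)"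
proof -
  have mm: "m \<in> Lc (arrows A.\<G>)" "m' \<in> Lc (arrows A.\<G>)"
    using m by (auto simp: A.bisection_pair_def)
  have "convolution A.\<G> n m' \<in> steinberg_diagonal A.\<G>" "convolution A.\<G> (convolution A.\<G> n m') m = n"
    using A.supp_subset_iff[OF n m] sub by auto
  then have "convolution B.\<G> (\<Gamma> n) (\<Gamma> m') \<in> steinberg_diagonal B.\<G> \<and>
      convolution B.\<G> (convolution B.\<G> (\<Gamma> n) (\<Gamma> m')) (\<Gamma> m) = \<Gamma> n"
    using n mm \<Gamma>_diagonal by (metis A.Lc_convolution \<Gamma>_convolution imageI)
  then show ?thesis
    using B.supp_subset_iff[OF \<Gamma>_in[OF n] \<Gamma>_bisection_pair[OF m]] by blast
qed

section \<open>The order isomorphism between the bisections\<close>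

definition L :: "('g \<times> 'x) set \<Rightarrow> ('h \<times> 'y) set"
  where "L B = supp (\<Gamma> (char_fun B))"

lemma L_bisection: "B \<in> A.bisections \<Longrightarrow> L B \<in> B.bisections"
  unfolding L_def by (rule B.bisection_pair_bisection[OF \<Gamma>_bisection_pair[OF A.char_fun_bisection_pair]])

lemma L_mono: "B \<in> A.bisections \<Longrightarrow> C \<in> A.bisections \<Longrightarrow> B \<subseteq> C \<Longrightarrow> L B \<subseteq> L C"
  unfolding L_def by (rule \<Gamma>_supp_mono[OF A.Lc_char_fun A.char_fun_bisection_pair]) auto

text \<open>Two normalizers with equal supports bound each other in the inclusion order, whatever
  invertible values they take. This permits composing \<open>L\<close> with the corresponding map
  for the inverse of \<open>\<Gamma>\<close>, although \<open>\<Gamma> (char_fun B)\<close> need not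
  be an indicator.\<close>

lemma \<Gamma>_supp:
  assumes n: "A.bisection_pair n n'" shows "supp (\<Gamma> n) = L (supp n)"
proof -
  have B: "supp n \<in> A.bisections"
    by (rule A.bisection_pair_bisection[OF n])
  have "n \<in> Lc (arrows A.\<G>)"
    using n by (simp add: A.bisection_pair_def)
  then have "supp (\<Gamma> n) \<subseteq> L (supp n)"
    unfolding L_def by (rule \<Gamma>_supp_mono[OF _ A.char_fun_bisection_pair[OF B]]) simp
  moreover have "L (supp n) \<subseteq> supp (\<Gamma> n)"
    unfolding L_def by (rule \<Gamma>_supp_mono[OF A.Lc_char_fun[OF B] n]) simp
  ultimately show ?thesis by blast
qed

lemma L_units:
  assumes "W \<in> A.bisections" "W \<subseteq> A.units" shows "L W \<subseteq> B.units"
proof -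
  have "(char_fun W :: _ \<Rightarrow> 'r) \<in> steinberg_diagonal A.\<G>"
    using assms A.Lc_char_fun by (simp add: diagonal_iff)
  then have "\<Gamma> (char_fun W) \<in> steinberg_diagonal B.\<G>"
    unfolding \<Gamma>_diagonal[symmetric] by (rule imageI)
  then show ?thesis
    by (simp add: L_def diagonal_iff)
qed

lemma L_mult:
  assumes B: "B \<in> A.bisections" and C: "C \<in> A.bisections" and c: "c \<in> L (A.bis_mult B C)"
  obtains a b where "a \<in> L B" "b \<in> L C" "B.cmp a b" "gmult B.\<G> a b = c"
proof -
  have "convolution B.\<G> (\<Gamma> (char_fun B)) (\<Gamma> (char_fun C)) c \<noteq> 0"
    using c \<Gamma>_convolution[OF A.Lc_char_fun[OF B] A.Lc_char_fun[OF C]]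
    by (simp add: L_def A.convolution_char_fun[OF B] in_supp)
  then show thesis
    using that by (elim convolution_nonzeroE) (auto simp: L_def in_supp)
qed

lemma L_inverse:
  assumes B: "B \<in> A.bisections"
  shows "diagonal_iso.L (inv_into (Lc (arrows A.\<G>)) \<Gamma>) (L B) = B"
proof -
  interpret inv: diagonal_iso H Y E \<gamma> G X D \<theta> "inv_into (Lc (arrows A.\<G>)) \<Gamma>"
    by (rule inverse)
  have "inv.L (L B) = supp (inv_into (Lc (arrows A.\<G>)) \<Gamma> (\<Gamma> (char_fun B)))"
    using inv.\<Gamma>_supp[OF \<Gamma>_bisection_pair[OF A.char_fun_bisection_pair[OF B]]] by (simp add: L_def)
  also have "\<dots> = B"
    by (subst inv_into_f_f[OF bij_betw_imp_inj_on[OF bij] A.Lc_char_fun[OF B]]) simp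
  finally show ?thesis .
qed

lemma L_order:
  assumes B: "B \<in> A.bisections" and C: "C \<in> A.bisections"
  shows "L B \<subseteq> L C \<longleftrightarrow> B \<subseteq> C"
proof
  assume sub: "L B \<subseteq> L C"
  interpret inv: diagonal_iso H Y E \<gamma> G X D \<theta> "inv_into (Lc (arrows A.\<G>)) \<Gamma>"
    by (rule inverse)
  show "B \<subseteq> C"
    using inv.L_mono[OF L_bisection[OF B] L_bisection[OF C] sub] L_inverse B C by simp
qed (rule L_mono[OF B C])

lemma L_image: "L ` A.bisections = B.bisections"
proof
  show "L ` A.bisections \<subseteq> B.bisections"
    using L_bisection by blast
  show "B.bisections \<subseteq> L ` A.bisections"
  proof
    fix C assume C: "C \<in> B.bisections"
    interpret inv: diagonal_iso H Y E \<gamma> G X D \<theta> "inv_into (Lc (arrows A.\<G>)) \<Gamma>"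
      by (rule inverse)
    let ?n = "inv_into (Lc (arrows A.\<G>)) \<Gamma> (char_fun C)"
    note n = inv.\<Gamma>_bisection_pair[OF B.char_fun_bisection_pair[OF C]]
    have "\<Gamma> ?n = char_fun C"
      by (rule bij_betw_inv_into_right[OF bij B.Lc_char_fun[OF C]])
    then have "L (supp ?n) = C"
      using \<Gamma>_supp[OF n] by simp
    then show "C \<in> L ` A.bisections"
      using A.bisection_pair_bisection[OF n] by blast
  qed
qed

lemma groupoid_iso: "\<exists>\<phi>. top_groupoid_iso A.\<G> B.\<G> \<phi>"
proof -
  obtain \<phi> where homeo: "homeomorphic_map (arrows A.\<G>) (arrows B.\<G>) \<phi>"
    and \<phi>: "\<And>a B. a \<in> B \<Longrightarrow> B \<in> A.bisections \<Longrightarrow> \<phi> a \<in> L B"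
    and uniq: "\<And>a b. a \<in> A.Ar \<Longrightarrow> b \<in> B.Ar \<Longrightarrow> (\<And>B. B \<in> A.bisections \<Longrightarrow> a \<in> B \<Longrightarrow> b \<in> L B) \<Longrightarrow> b = \<phi> a"
    using base_iso_homeomorphism[OF A.Hausdorff_arrows B.Hausdorff_arrows A.bisections_base B.bisections_base L_image L_order]
    by metis
  have \<phi>_in: "\<phi> a \<in> B.Ar" if "a \<in> A.Ar" for a
    using homeo that homeomorphic_imp_surjective_map by blast
  have nbhd: "\<exists>B\<in>A.bisections. a \<in> B" if "a \<in> A.Ar" for a
    using A.bisection_base[OF openin_topspace that] by metis
  have unit_nbhd: "B \<inter> A.units \<in> A.bisections" if "B \<in> A.bisections" for B
    by (rule A.bisection_restrict[OF that])
      (use that A.units_clopen compact_Int_closedin in \<open>auto simp: A.bisections_def\<close>)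
  have rng: "B.rng (\<phi> a) = \<phi> (A.rng a)" if a: "a \<in> A.Ar" for a
  proof (rule uniq)
    show "A.rng a \<in> A.Ar" "B.rng (\<phi> a) \<in> B.Ar"
      using a \<phi>_in A.rng_units A.unit_facts(1) B.rng_units B.unit_facts(1) by blast+
    fix B assume B: "B \<in> A.bisections" "A.rng a \<in> B"
    \<comment> \<open>As \<open>a\<close> is \<open>rng a\<close> times \<open>a\<close>, it lies in
      the product of \<open>W\<close> with any bisection \<open>C\<close> around \<open>a\<close>.
      So \<open>\<phi> a\<close> has a left factor in \<open>L W\<close>, which is a unit and
      therefore the range of \<open>\<phi> a\<close>.\<close>
    define W where "W = B \<inter> A.units"
    have W: "W \<in> A.bisections" "W \<subseteq> A.units" "A.rng a \<in> W"
      using unit_nbhd[OF B(1)] B(2) A.rng_units[OF a] by (auto simp: W_def)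
    obtain C where C: "C \<in> A.bisections" "a \<in> C"
      using nbhd[OF a] by blast
    have "a \<in> A.bis_mult W C"
      using A.bis_multI[OF W(3) C(2) A.comp_rng(1)[OF a]] by (simp add: A.comp_rng(2)[OF a])
    then have "\<phi> a \<in> L (A.bis_mult W C)"
      by (rule \<phi>[OF _ A.bisection_mult[OF W(1) C(1)]])
    then obtain u e where ue: "u \<in> L W" "B.cmp u e" "gmult B.\<G> u e = \<phi> a"
      by (rule L_mult[OF W(1) C(1)])
    then have "B.rng (\<phi> a) = u"
      using B.unit_left[OF ue(2)] L_units[OF W(1,2)] by auto
    moreover have "L W \<subseteq> L B"
      using L_mono W(1) B(1) by (simp add: W_def)
    ultimately show "B.rng (\<phi> a) \<in> L B"
      using ue(1) by blast
  qed
  have src: "B.src (\<phi> a) = \<phi> (A.src a)" if a: "a \<in> A.Ar" for a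
  proof (rule uniq)
    show "A.src a \<in> A.Ar" "B.src (\<phi> a) \<in> B.Ar"
      using a \<phi>_in A.src_units A.unit_facts(1) B.src_units B.unit_facts(1) by blast+
    fix B assume B: "B \<in> A.bisections" "A.src a \<in> B"
    define W where "W = B \<inter> A.units"
    have W: "W \<in> A.bisections" "W \<subseteq> A.units" "A.src a \<in> W"
      using unit_nbhd[OF B(1)] B(2) A.src_units[OF a] by (auto simp: W_def)
    obtain C where C: "C \<in> A.bisections" "a \<in> C"
      using nbhd[OF a] by blast
    have "a \<in> A.bis_mult C W"
      using A.bis_multI[OF C(2) W(3) A.comp_src(1)[OF a]] by (simp add: A.comp_src(2)[OF a])
    then have "\<phi> a \<in> L (A.bis_mult C W)"
      by (rule \<phi>[OF _ A.bisection_mult[OF C(1) W(1)]])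
    then obtain e u where ue: "u \<in> L W" "B.cmp e u" "gmult B.\<G> e u = \<phi> a"
      by (rule L_mult[OF C(1) W(1)])
    then have "B.src (\<phi> a) = u"
      using B.unit_right[OF ue(2)] L_units[OF W(1,2)] by auto
    moreover have "L W \<subseteq> L B"
      using L_mono W(1) B(1) by (simp add: W_def)
    ultimately show "B.src (\<phi> a) \<in> L B"
      using ue(1) by blast
  qed
  have mult: "\<phi> (gmult A.\<G> a b) = gmult B.\<G> (\<phi> a) (\<phi> b)" if ab: "A.cmp a b" for a b
  proof -
    have abA: "a \<in> A.Ar" "b \<in> A.Ar" "gmult A.\<G> a b \<in> A.Ar"
      using ab A.mul_in[OF ab] by (auto simp: A.comp_iff)
    obtain B where B: "B \<in> A.bisections" "a \<in> B"
      using nbhd[OF abA(1)] by blast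
    obtain C where C: "C \<in> A.bisections" "b \<in> C"
      using nbhd[OF abA(2)] by blast
    have "gmult A.\<G> a b \<in> A.bis_mult B C"
      by (rule A.bis_multI[OF B(2) C(2) ab])
    then have "\<phi> (gmult A.\<G> a b) \<in> L (A.bis_mult B C)"
      by (rule \<phi>[OF _ A.bisection_mult[OF B(1) C(1)]])
    then obtain a' b' where a'b': "a' \<in> L B" "b' \<in> L C" "B.cmp a' b'" "gmult B.\<G> a' b' = \<phi> (gmult A.\<G> a b)"
      by (rule L_mult[OF B(1) C(1)])
    \<comment> \<open>Both \<open>a'\<close> and \<open>\<phi> a\<close> belong to the bisection
      \<open>L B\<close>, so equal ranges make them equal; sources do the same for \<open>b'\<close>
      and \<open>\<phi> b\<close> in \<open>L C\<close>.\<close>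
    have "B.rng a' = B.rng (\<phi> a)"
      using B.rng_mul[OF a'b'(3)] rng[OF abA(3)] rng[OF abA(1)] A.rng_mul[OF ab] a'b'(4) by simp
    moreover have "inj_on B.rng (L B)"
      using L_bisection[OF B(1)] by (simp add: B.bisections_def)
    ultimately have "a' = \<phi> a"
      using a'b'(1) \<phi>[OF B(2,1)] by (auto dest: inj_onD)
    have "B.src b' = B.src (\<phi> b)"
      using B.src_mul[OF a'b'(3)] src[OF abA(3)] src[OF abA(2)] A.src_mul[OF ab] a'b'(4) by simp
    moreover have "inj_on B.src (L C)"
      using L_bisection[OF C(1)] by (simp add: B.bisections_def)
    ultimately have "b' = \<phi> b"
      using a'b'(2) \<phi>[OF C(2,1)] by (auto dest: inj_onD)
    then show ?thesis
      using \<open>a' = \<phi> a\<close> a'b'(4) by simp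
  qed
  have "\<phi> ` A.units \<subseteq> B.units"
  proof
    fix b assume "b \<in> \<phi> ` A.units"
    then obtain u where u: "u \<in> A.units" "b = \<phi> u" by blast
    then have "B.rng b = b"
      using rng[OF A.unit_facts(1)[OF u(1)]] A.unit_facts(3)[OF u(1)] by simp
    then show "b \<in> B.units"
      using B.rng_units[of b] \<phi>_in[OF A.unit_facts(1)[OF u(1)]] u(2) by simp
  qed
  then have "top_groupoid_iso A.\<G> B.\<G> \<phi>"
    unfolding top_groupoid_iso_def using homeo rng src mult by blast
  then show ?thesis by blast
qed

end

section \<open>Groupoid isomorphisms induce algebra isomorphisms\<close>

text \<open>At nonzero values the level sets of the transported function are images of level sets of
  \<open>f\<close> under the open map \<open>\<phi>\<close>. The value \<open>0\<close> off
  \<open>topspace T\<close> follows the convention that functions are extended by zero.\<close>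

lemma Lc_transport:
  fixes f :: "'a \<Rightarrow> 'r::zero"
  assumes hm: "homeomorphic_maps S T \<phi> \<psi>" and T: "Hausdorff_space T" and f: "f \<in> Lc S"
  shows "(\<lambda>b. if b \<in> topspace T then f (\<psi> b) else 0) \<in> Lc T" (is "?g \<in> _")
    and "supp (\<lambda>b. if b \<in> topspace T then f (\<psi> b) else 0) = \<phi> ` supp f"
proof -
  have maps: "\<psi> (\<phi> a) = a" "\<phi> a \<in> topspace T" if "a \<in> topspace S" for a
    using hm that continuous_map_image_subset_topspace[of S T \<phi>] by (auto simp: homeomorphic_maps_def)
  have maps': "\<phi> (\<psi> b) = b" "\<psi> b \<in> topspace S" if "b \<in> topspace T" for b
    using hm that continuous_map_image_subset_topspace[of T S \<psi>] by (auto simp: homeomorphic_maps_def)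
  have level: "{b. ?g b \<in> A} = \<phi> ` {a. f a \<in> A}" if "0 \<notin> A" for A
  proof
    show "{b. ?g b \<in> A} \<subseteq> \<phi> ` {a. f a \<in> A}"
    proof
      fix b assume b: "b \<in> {b. ?g b \<in> A}"
      then have "b \<in> topspace T" "f (\<psi> b) \<in> A"
        using that by (auto split: if_splits)
      then show "b \<in> \<phi> ` {a. f a \<in> A}"
        using maps'(1) by (metis (mono_tags) image_eqI mem_Collect_eq)
    qed
    show "\<phi> ` {a. f a \<in> A} \<subseteq> {b. ?g b \<in> A}"
    proof clarify
      fix a assume a: "f a \<in> A"
      then have "a \<in> topspace S"
        using that Lc_supp(2)[OF f] by (auto simp: supp_def)
      then show "?g (\<phi> a) \<in> A"
        using a maps by simp
    qed
  qed
  from level[of "-{0}"] show supp: "supp ?g = \<phi> ` supp f"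
    by (simp add: supp_def)
  show "?g \<in> Lc T"
  proof (rule Hausdorff_LcI[OF T])
    show "compactin T (supp ?g)"
      unfolding supp using hm by (intro image_compactin[OF Lc_supp(1)[OF f]]) (simp add: homeomorphic_maps_def)
    have "open_map S T \<phi>"
      using hm homeomorphic_maps_imp_map homeomorphic_imp_open_map by blast
    then show "openin T {b. ?g b = v}" if "v \<noteq> 0" for v
      using level[of "{v}"] Lc_level_open[OF f, of "{v}"] that by (simp add: open_map_def)
  qed
qed

text \<open>The algebra isomorphism is composition with the inverse homeomorphism. It respects
  convolution because \<open>\<phi>\<close> carries the factorizations of \<open>\<psi> b\<close>
  bijectively to those of \<open>b\<close>.\<close>

lemma groupoid_iso_imp_diagonal_iso:
  assumes "ample_action G X D \<theta>" and "ample_action H Y E \<gamma>"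
    and iso: "top_groupoid_iso (transformation_groupoid G X D \<theta>) (transformation_groupoid H Y E \<gamma>) \<phi>"
  shows "\<exists>\<Gamma> :: ('g \<times> 'x \<Rightarrow> 'r::comm_ring_1) \<Rightarrow> ('h \<times> 'y \<Rightarrow> 'r).
    diagonal_preserving_iso (transformation_groupoid G X D \<theta>) (transformation_groupoid H Y E \<gamma>) \<Gamma>"
proof -
  interpret A: ample_action G X D \<theta> by fact
  interpret B: ample_action H Y E \<gamma> by fact
  obtain \<psi> where hm: "homeomorphic_maps (arrows A.\<G>) (arrows B.\<G>) \<phi> \<psi>"
    using iso homeomorphic_map_maps[of _ _ \<phi>] by (meson top_groupoid_iso_def)
  then have hm': "homeomorphic_maps (arrows B.\<G>) (arrows A.\<G>) \<psi> \<phi>"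
    by (auto simp: homeomorphic_maps_def)
  have \<phi>: "\<psi> (\<phi> a) = a" "\<phi> a \<in> B.Ar" "B.rng (\<phi> a) = \<phi> (A.rng a)" "B.src (\<phi> a) = \<phi> (A.src a)" if "a \<in> A.Ar" for a
    using hm that continuous_map_image_subset_topspace[of "arrows A.\<G>" "arrows B.\<G>" \<phi>] iso
    unfolding homeomorphic_maps_def top_groupoid_iso_def by blast+
  have \<psi>: "\<phi> (\<psi> b) = b" "\<psi> b \<in> A.Ar" if "b \<in> B.Ar" for b
    using hm that continuous_map_image_subset_topspace[of "arrows B.\<G>" "arrows A.\<G>" \<psi>]
    unfolding homeomorphic_maps_def by blast+
  \<comment> \<open>A groupoid isomorphism is only required to send units to units; the converse
    follows from the ranges, because an arrow is a unit exactly if it equals its range.\<close>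
  have units: "\<phi> a \<in> B.units \<longleftrightarrow> a \<in> A.units" if a: "a \<in> A.Ar" for a
  proof
    assume "\<phi> a \<in> B.units"
    then have "\<phi> (A.rng a) = \<phi> a"
      using \<phi>(3)[OF a] B.unit_facts(3) by simp
    then have "A.rng a = a"
      using \<phi>(1) a A.unit_facts(1)[OF A.rng_units[OF a]] by metis
    then show "a \<in> A.units"
      using A.rng_units[OF a] by simp
  qed (use iso in \<open>auto simp: top_groupoid_iso_def\<close>)
  have cmp: "B.cmp (\<phi> a) (\<phi> b) \<longleftrightarrow> A.cmp a b" if "a \<in> A.Ar" "b \<in> A.Ar" for a b
    using \<phi> that A.unit_facts(1)[OF A.rng_units] A.unit_facts(1)[OF A.src_units] unfolding A.comp_iff B.comp_iff by metis
  have mult: "\<phi> (gmult A.\<G> a b) = gmult B.\<G> (\<phi> a) (\<phi> b)" if "A.cmp a b" for a b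
    using iso that unfolding top_groupoid_iso_def by blast
  define \<Gamma> :: "('g \<times> 'x \<Rightarrow> 'r) \<Rightarrow> 'h \<times> 'y \<Rightarrow> 'r"
    where "\<Gamma> f = (\<lambda>b. if b \<in> B.Ar then f (\<psi> b) else 0)" for f
  define \<Delta> :: "('h \<times> 'y \<Rightarrow> 'r) \<Rightarrow> 'g \<times> 'x \<Rightarrow> 'r"
    where "\<Delta> f = (\<lambda>a. if a \<in> A.Ar then f (\<phi> a) else 0)" for f
  have \<Gamma>_in: "\<Gamma> f \<in> Lc (arrows B.\<G>)" "supp (\<Gamma> f) = \<phi> ` supp f" if "f \<in> Lc (arrows A.\<G>)" for f
    using Lc_transport[OF hm B.Hausdorff_arrows that] by (simp_all add: \<Gamma>_def)
  have \<Delta>_in: "\<Delta> f \<in> Lc (arrows A.\<G>)" "supp (\<Delta> f) = \<psi> ` supp f" if "f \<in> Lc (arrows B.\<G>)" for f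
    using Lc_transport[OF hm' A.Hausdorff_arrows that] by (simp_all add: \<Delta>_def)
  have \<Delta>\<Gamma>: "\<Delta> (\<Gamma> f) = f" if f: "f \<in> Lc (arrows A.\<G>)" for f
  proof
    fix a show "\<Delta> (\<Gamma> f) a = f a"
      using \<phi>(1,2)[of a] A.Lc_in_Ar[OF f, of a] by (cases "a \<in> A.Ar") (auto simp: \<Delta>_def \<Gamma>_def)
  qed
  have \<Gamma>\<Delta>: "\<Gamma> (\<Delta> f) = f" if f: "f \<in> Lc (arrows B.\<G>)" for f
  proof
    fix b show "\<Gamma> (\<Delta> f) b = f b"
      using \<psi>[of b] B.Lc_in_Ar[OF f, of b] by (cases "b \<in> B.Ar") (auto simp: \<Delta>_def \<Gamma>_def)
  qed
  have bij: "bij_betw \<Gamma> (Lc (arrows A.\<G>)) (Lc (arrows B.\<G>))"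
    by (rule bij_betw_byWitness[of _ \<Delta>]) (use \<Delta>\<Gamma> \<Gamma>\<Delta> \<Gamma>_in(1) \<Delta>_in(1) in blast)+
  have conv: "\<Gamma> (convolution A.\<G> f g) = convolution B.\<G> (\<Gamma> f) (\<Gamma> g)"
    if f: "f \<in> Lc (arrows A.\<G>)" and g: "g \<in> Lc (arrows A.\<G>)" for f g
  proof
    fix b
    show "\<Gamma> (convolution A.\<G> f g) b = convolution B.\<G> (\<Gamma> f) (\<Gamma> g) b"
    proof (cases "b \<in> B.Ar")
      case False
      have "convolution B.\<G> (\<Gamma> f) (\<Gamma> g) b = 0"
        using False B.mul_in by (metis convolution_nonzeroE)
      then show ?thesis
        using False by (simp add: \<Gamma>_def)
    next
      case True
      let ?P = "{(c, d). A.cmp c d \<and> gmult A.\<G> c d = \<psi> b \<and> f c \<noteq> 0 \<and> g d \<noteq> 0}"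
      let ?Q = "{(c, d). B.cmp c d \<and> gmult B.\<G> c d = b \<and> \<Gamma> f c \<noteq> 0 \<and> \<Gamma> g d \<noteq> 0}"
      let ?e = "\<lambda>(c, d). (\<phi> c, \<phi> d)"
      have val: "\<Gamma> h (\<phi> a) = h a" if "a \<in> A.Ar" for h a
        using \<phi> that by (simp add: \<Gamma>_def)
      have "?Q = ?e ` ?P"
      proof
        show "?e ` ?P \<subseteq> ?Q"
        proof (rule image_subsetI, clarify)
          fix c d assume cd: "A.cmp c d" "gmult A.\<G> c d = \<psi> b" "f c \<noteq> 0" "g d \<noteq> 0"
          then have "c \<in> A.Ar" "d \<in> A.Ar"
            by (auto simp: A.comp_iff)
          then show "B.cmp (\<phi> c) (\<phi> d) \<and> gmult B.\<G> (\<phi> c) (\<phi> d) = b \<and> \<Gamma> f (\<phi> c) \<noteq> 0 \<and> \<Gamma> g (\<phi> d) \<noteq> 0"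
            using cd cmp[of c d] mult[OF cd(1), symmetric] \<psi>(1)[OF True] by (simp add: val)
        qed
        show "?Q \<subseteq> ?e ` ?P"
        proof
          fix p assume "p \<in> ?Q"
          then obtain c' d' where p: "p = (c', d')"
            and cd': "B.cmp c' d'" "gmult B.\<G> c' d' = b" "\<Gamma> f c' \<noteq> 0" "\<Gamma> g d' \<noteq> 0"
            by blast
          define c d where "c = \<psi> c'" and "d = \<psi> d'"
          have cd: "c \<in> A.Ar" "d \<in> A.Ar" "c' = \<phi> c" "d' = \<phi> d"
            using cd'(1) \<psi> by (auto simp: B.comp_iff c_def d_def)
          then have "A.cmp c d"
            using cmp cd'(1) by simp
          moreover from this have "gmult A.\<G> c d = \<psi> b"
            using mult \<phi>(1)[OF A.mul_in] cd cd'(2) by metis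
          ultimately have "(c, d) \<in> ?P"
            using cd' cd val by simp
          then show "p \<in> ?e ` ?P"
            using cd p by (intro image_eqI[of _ _ "(c, d)"]) auto
        qed
      qed
      moreover have "inj_on ?e ?P"
      proof (rule inj_on_inverseI)
        fix p assume "p \<in> ?P"
        then obtain c d where "p = (c, d)" "A.cmp c d"
          by blast
        then show "map_prod \<psi> \<psi> (?e p) = p"
          using \<phi>(1) unfolding A.comp_iff by simp
      qed
      ultimately have "convolution B.\<G> (\<Gamma> f) (\<Gamma> g) b = (\<Sum>(c, d)\<in>?P. \<Gamma> f (\<phi> c) * \<Gamma> g (\<phi> d))"
        unfolding convolution_def by (simp add: sum.reindex case_prod_unfold)
      also have "\<dots> = (\<Sum>(c, d)\<in>?P. f c * g d)"
        by (rule sum.cong) (auto simp: A.comp_iff val simp del: A.Ar_pair)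
      also have "\<dots> = \<Gamma> (convolution A.\<G> f g) b"
        using True by (simp add: \<Gamma>_def convolution_def)
      finally show ?thesis by simp
    qed
  qed
  have "\<Gamma> ` steinberg_diagonal A.\<G> = steinberg_diagonal B.\<G>"
  proof
    show "\<Gamma> ` steinberg_diagonal A.\<G> \<subseteq> steinberg_diagonal B.\<G>"
    proof (rule image_subsetI)
      fix f :: "'g \<times> 'x \<Rightarrow> 'r" assume "f \<in> steinberg_diagonal A.\<G>"
      then show "\<Gamma> f \<in> steinberg_diagonal B.\<G>"
        using \<Gamma>_in[of f] iso by (simp add: diagonal_iff top_groupoid_iso_def) blast
    qed
    show "steinberg_diagonal B.\<G> \<subseteq> \<Gamma> ` steinberg_diagonal A.\<G>"
    proof
      fix f :: "'h \<times> 'y \<Rightarrow> 'r" assume f: "f \<in> steinberg_diagonal B.\<G>"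
      then have fL: "f \<in> Lc (arrows B.\<G>)" "supp f \<subseteq> B.units"
        by (auto simp: diagonal_iff)
      have "supp (\<Delta> f) \<subseteq> A.units"
        unfolding \<Delta>_in(2)[OF fL(1)]
      proof (rule image_subsetI)
        fix b assume "b \<in> supp f"
        then have "b \<in> B.units" using fL(2) by blast
        then show "\<psi> b \<in> A.units"
          using units[of "\<psi> b"] \<psi>[of b] B.unit_facts(1)[of b] by simp
      qed
      then have "\<Delta> f \<in> steinberg_diagonal A.\<G>"
        using \<Delta>_in(1)[OF fL(1)] by (simp add: diagonal_iff)
      then show "f \<in> \<Gamma> ` steinberg_diagonal A.\<G>"
        using \<Gamma>\<Delta>[OF fL(1)] by force
    qed
  qed
  moreover have "algebra_iso (steinberg_algebra A.\<G>) (steinberg_algebra B.\<G>) \<Gamma>"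
    using bij conv by (simp add: algebra_iso_def steinberg_algebra_def) (simp add: \<Gamma>_def fun_eq_iff)
  ultimately show ?thesis
    unfolding diagonal_preserving_iso_def by blast
qed

section \<open>The partial skew group ring as a Steinberg algebra\<close>

context ample_action
begin

lemma skew_supp_eq: "skew_supp F = fst ` supp (case_prod F)"
proof
  show "skew_supp F \<subseteq> fst ` supp (case_prod F)"
  proof
    fix g assume "g \<in> skew_supp F"
    then obtain x where "F g x \<noteq> 0"
      by (auto simp: skew_supp_def fun_eq_iff)
    then show "g \<in> fst ` supp (case_prod F)"
      by (intro image_eqI[of _ _ "(g, x)"]) (auto simp: supp_def)
  qed
qed (auto simp: skew_supp_def supp_def fun_eq_iff)

text \<open>Membership of the components in the ideals says that the uncurried function vanishes off
  the arrows.\<close>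

lemma skew_carrier_iff:
  fixes F :: "'a \<Rightarrow> 'c \<Rightarrow> 'r::comm_ring_1"
  shows "F \<in> alg_carrier (skew_ring G X D \<theta>) \<longleftrightarrow> case_prod F \<in> Lc (arrows \<G>)"
proof
  assume "F \<in> alg_carrier (skew_ring G X D \<theta>)"
  then have F: "finite (skew_supp F)" "skew_supp F \<subseteq> carrier G"
    "\<And>g. g \<in> carrier G \<Longrightarrow> F g \<in> Lc X" "\<And>g x. g \<in> carrier G \<Longrightarrow> x \<in> topspace X - D g \<Longrightarrow> F g x = 0"
    by (auto simp: skew_ring_def skew_ideal_def)
  have "supp (case_prod F) \<subseteq> Ar"
  proof (rule subsetI, clarify)
    fix g x assume gx: "(g, x) \<in> supp (case_prod F)"
    then have g: "g \<in> carrier G"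
      using F(2) unfolding skew_supp_eq by force
    have "F g x \<noteq> 0"
      using gx by (simp add: supp_def)
    then have "x \<in> topspace X" "x \<in> D g"
      using F(4)[OF g, of x] Lc_supp(2)[OF F(3)[OF g]] by (auto simp: supp_def)
    then show "(g, x) \<in> Ar"
      using g by simp
  qed
  then show "case_prod F \<in> Lc (arrows \<G>)"
    using F(1,3) by (simp add: Lc_arrows skew_supp_eq)
next
  assume F: "case_prod F \<in> Lc (arrows \<G>)"
  then have Ar: "supp (case_prod F) \<subseteq> Ar"
    by (simp add: Lc_arrows)
  have "skew_supp F \<subseteq> carrier G"
    unfolding skew_supp_eq using Ar by force
  moreover have "F g x = 0" if "g \<in> carrier G" "x \<in> topspace X - D g" for g x
    using Lc_in_Ar[OF F, of "(g, x)"] that by auto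
  ultimately show "F \<in> alg_carrier (skew_ring G X D \<theta>)"
    using F by (auto simp: Lc_arrows skew_ring_def skew_ideal_def skew_supp_eq)
qed

text \<open>For \<open>x \<in> D g\<close> the inner \<open>skew_alpha\<close> is undone by the
  outer one on the first factor, since \<open>\<theta> g (\<theta> (inv g) x) = x\<close>, and only
  the second factor is moved; outside \<open>D g\<close> both formulas vanish because
  \<open>F g\<close> does. What remains is the double sum of
  \<open>convolution_pair\<close>.\<close>

lemma case_prod_skew_mult:
  fixes F K :: "'a \<Rightarrow> 'c \<Rightarrow> 'r::comm_ring_1"
  assumes F: "case_prod F \<in> Lc (arrows \<G>)" and K: "case_prod K \<in> Lc (arrows \<G>)"
  shows "case_prod (skew_mult G D \<theta> F K) = convolution \<G> (case_prod F) (case_prod K)"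
proof (rule ext, clarify)
  fix k x
  have "skew_delta (g \<otimes> h) (skew_alpha G D \<theta> g (\<lambda>y. skew_alpha G D \<theta> (inv g) (F g) y * K h y)) k x =
      (if g \<otimes> h = k then F g x * K h (\<theta> (inv g) x) else 0)"
    if "g \<in> skew_supp F" for g h
  proof -
    have g: "g \<in> carrier G"
      using that Lc_supp(2)[OF F] unfolding skew_supp_eq by auto
    show ?thesis
    proof (cases "x \<in> D g")
      case True
      then show ?thesis
        using act_inv_in[OF g True] act_cancel[OF g True] g by (auto simp: skew_delta_def skew_alpha_def)
    next
      case False
      then have "F g x = 0"
        using Lc_in_Ar[OF F, of "(g, x)"] by auto
      then show ?thesis
        using False by (simp add: skew_delta_def skew_alpha_def)
    qed
  qed
  then show "skew_mult G D \<theta> F K k x = convolution \<G> (case_prod F) (case_prod K) (k, x)"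
    unfolding convolution_pair[OF F K] skew_mult_def skew_supp_eq[symmetric] by (intro sum.cong) auto
qed

lemma skew_ring_iso:
  "algebra_iso (skew_ring G X D \<theta>) (steinberg_algebra \<G> :: ('r::comm_ring_1, 'a \<times> 'c \<Rightarrow> 'r) ralgebra) case_prod"
proof -
  let ?C = "alg_carrier (skew_ring G X D \<theta> :: ('r, 'a \<Rightarrow> 'c \<Rightarrow> 'r) ralgebra)"
  have "bij_betw case_prod ?C (Lc (arrows \<G>))"
    by (rule bij_betw_byWitness[of _ curry]) (auto simp: skew_carrier_iff)
  moreover have "case_prod (skew_mult G D \<theta> F K) = convolution \<G> (case_prod F) (case_prod K)"
    if "F \<in> ?C" "K \<in> ?C" for F K
    using that by (simp add: skew_carrier_iff case_prod_skew_mult)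
  ultimately show ?thesis
    unfolding algebra_iso_def by (simp add: steinberg_algebra_def) (auto simp: skew_ring_def fun_eq_iff)
qed

text \<open>The units form the slice over \<open>\<one>\<close>, and \<open>D \<one>\<close> is all
  of \<open>X\<close>, so the diagonal functions are the uncurried monomials at
  \<open>\<one>\<close>.\<close>

lemma case_prod_Lc_in_skew:
  "case_prod ` Lc_in_skew G X = (steinberg_diagonal \<G> :: ('a \<times> 'c \<Rightarrow> 'r::comm_ring_1) set)"
proof
  show "case_prod ` Lc_in_skew G X \<subseteq> (steinberg_diagonal \<G> :: ('a \<times> 'c \<Rightarrow> 'r) set)"
  proof (clarsimp simp: Lc_in_skew_def)
    fix f :: "'c \<Rightarrow> 'r" assume f: "f \<in> Lc X"
    have supp: "supp (case_prod (skew_delta \<one> f)) = {\<one>} \<times> supp f"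
      by (auto simp: supp_def skew_delta_def split: if_splits)
    have slice: "(\<lambda>x. skew_delta \<one> f t x) = (if t = \<one> then f else (\<lambda>x. 0))" for t
      by (auto simp: skew_delta_def)
    have "case_prod (skew_delta \<one> f) \<in> Lc (arrows \<G>)"
      unfolding Lc_arrows supp
      using f Lc_supp(2)[OF f] by (auto simp: slice dom_one Lc_zero finite_subset[of _ "{\<one>}"])
    moreover have "{\<one>} \<times> supp f \<subseteq> units"
      using Lc_supp(2)[OF f] by (auto simp: units_transformation)
    ultimately show "case_prod (skew_delta \<one> f) \<in> steinberg_diagonal \<G>"
      by (simp add: diagonal_iff supp)
  qed
  show "(steinberg_diagonal \<G> :: ('a \<times> 'c \<Rightarrow> 'r) set) \<subseteq> case_prod ` Lc_in_skew G X"
  proof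
    fix d :: "'a \<times> 'c \<Rightarrow> 'r" assume "d \<in> steinberg_diagonal \<G>"
    then have d: "d \<in> Lc (arrows \<G>)" "supp d \<subseteq> {\<one>} \<times> topspace X"
      by (auto simp: diagonal_iff units_transformation)
    have "d = case_prod (skew_delta \<one> (\<lambda>x. d (\<one>, x)))"
    proof
      fix p
      show "d p = case_prod (skew_delta \<one> (\<lambda>x. d (\<one>, x))) p"
        using d(2) by (cases p) (auto simp: skew_delta_def supp_def)
    qed
    moreover have "(\<lambda>x. d (\<one>, x)) \<in> Lc X"
      using d(1) by (simp add: Lc_arrows)
    ultimately show "d \<in> case_prod ` Lc_in_skew G X"
      unfolding Lc_in_skew_def by blast
  qed
qed

lemma skew_ring_iso_inverse:
  obtains \<psi> :: "('a \<times> 'c \<Rightarrow> 'r::comm_ring_1) \<Rightarrow> ('a \<Rightarrow> 'c \<Rightarrow> 'r)"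
  where "algebra_iso (steinberg_algebra \<G>) (skew_ring G X D \<theta>) \<psi>" "\<psi> ` steinberg_diagonal \<G> = Lc_in_skew G X"
proof
  let ?S = "skew_ring G X D \<theta> :: ('r, 'a \<Rightarrow> 'c \<Rightarrow> 'r) ralgebra"
  let ?\<psi> = "inv_into (alg_carrier ?S) case_prod"
  have add: "case_prod (alg_add ?S F K) = (\<lambda>a. case_prod F a + case_prod K a)" for F K
    by (auto simp: skew_ring_def)
  have scale: "case_prod (alg_scale ?S r F) = (\<lambda>a. r * case_prod F a)" for r F
    by (auto simp: skew_ring_def)
  have mult: "alg_mult ?S = skew_mult G D \<theta>"
    by (simp add: skew_ring_def)
  show "algebra_iso (steinberg_algebra \<G>) ?S ?\<psi>"
    by (rule algebra_iso_inverse[OF skew_ring_iso])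
      (simp_all add: skew_carrier_iff add scale mult Lc_add Lc_scale Lc_convolution case_prod_skew_mult)
  have "(Lc_in_skew G X :: ('a \<Rightarrow> 'c \<Rightarrow> 'r) set) \<subseteq> alg_carrier ?S"
  proof
    fix F :: "'a \<Rightarrow> 'c \<Rightarrow> 'r" assume "F \<in> Lc_in_skew G X"
    then have "case_prod F \<in> case_prod ` Lc_in_skew G X"
      by (rule imageI)
    then have "case_prod F \<in> steinberg_diagonal \<G>"
      by (simp only: case_prod_Lc_in_skew)
    then show "F \<in> alg_carrier ?S"
      by (simp add: skew_carrier_iff diagonal_iff)
  qed
  moreover have "inj_on case_prod (alg_carrier ?S)"
    using skew_ring_iso[where 'r = 'r] by (auto simp: algebra_iso_def bij_betw_def)
  ultimately show "?\<psi> ` steinberg_diagonal \<G> = Lc_in_skew G X"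
    unfolding case_prod_Lc_in_skew[symmetric] by (rule inv_into_image_cancel[rotated])
qed

end

section \<open>Comparison of the three conditions\<close>

theorem theorem4p5:
  fixes G :: "('g, 'k) monoid_scheme" and H :: "('h, 'l) monoid_scheme"
    and X :: "'x topology" and Y :: "'y topology"
    and D :: "'g \<Rightarrow> 'x set" and \<theta> :: "'g \<Rightarrow> 'x \<Rightarrow> 'x"
    and E :: "'h \<Rightarrow> 'y set" and \<gamma> :: "'h \<Rightarrow> 'y \<Rightarrow> 'y"
  assumes "group G" and "group H"
    and "indicable_throughout G" and "indicable_throughout H"
    and "totally_disconnected_space X" and "locally_compact_space X" and "Hausdorff_space X"
    and "totally_disconnected_space Y" and "locally_compact_space Y" and "Hausdorff_space Y"
    and "partial_action G X D \<theta>" and "partial_action H Y E \<gamma>"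
    and "\<And>g. g \<in> carrier G \<Longrightarrow> openin X (D g) \<and> closedin X (D g)"
    and "\<And>h. h \<in> carrier H \<Longrightarrow> openin Y (E h) \<and> closedin Y (E h)"
  shows
    "((\<exists>\<phi>. top_groupoid_iso (transformation_groupoid G X D \<theta>) (transformation_groupoid H Y E \<gamma>) \<phi>)
      \<longleftrightarrow>
      (\<exists>\<Gamma> :: ('g \<times> 'x \<Rightarrow> 'r::idom) \<Rightarrow> ('h \<times> 'y \<Rightarrow> 'r).
         diagonal_preserving_iso (transformation_groupoid G X D \<theta>)
                                 (transformation_groupoid H Y E \<gamma>) \<Gamma>))
     \<and>
     ((\<exists>\<Gamma> :: ('g \<times> 'x \<Rightarrow> 'r) \<Rightarrow> ('h \<times> 'y \<Rightarrow> 'r).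
         diagonal_preserving_iso (transformation_groupoid G X D \<theta>)
                                 (transformation_groupoid H Y E \<gamma>) \<Gamma>)
      \<longleftrightarrow>
      (\<exists>\<Phi> :: ('g \<Rightarrow> 'x \<Rightarrow> 'r) \<Rightarrow> ('h \<Rightarrow> 'y \<Rightarrow> 'r).
         algebra_iso (skew_ring G X D \<theta>) (skew_ring H Y E \<gamma>) \<Phi> \<and>
         \<Phi> ` Lc_in_skew G X = Lc_in_skew H Y))"
proof -
  interpret A: ample_action G X D \<theta>
    using assms by (simp add: ample_action_def ample_action_axioms_def)
  interpret B: ample_action H Y E \<gamma>
    using assms by (simp add: ample_action_def ample_action_axioms_def)
  have i_ii: "\<exists>\<Gamma> :: ('g \<times> 'x \<Rightarrow> 'r) \<Rightarrow> ('h \<times> 'y \<Rightarrow> 'r). diagonal_preserving_iso A.\<G> B.\<G> \<Gamma>"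
    if "top_groupoid_iso A.\<G> B.\<G> \<phi>" for \<phi>
    using groupoid_iso_imp_diagonal_iso[OF A.ample_action_axioms B.ample_action_axioms that] .
  have ii_i: "\<exists>\<phi>. top_groupoid_iso A.\<G> B.\<G> \<phi>"
    if "diagonal_preserving_iso A.\<G> B.\<G> \<Gamma>" for \<Gamma> :: "('g \<times> 'x \<Rightarrow> 'r) \<Rightarrow> ('h \<times> 'y \<Rightarrow> 'r)"
  proof -
    interpret diagonal_iso G X D \<theta> H Y E \<gamma> \<Gamma>
      by unfold_locales (use assms that in auto)
    show ?thesis by (rule groupoid_iso)
  qed
  \<comment> \<open>Conditions (ii) and (iii) are exchanged by composing with uncurrying on one side
    and with its inverse on the other.\<close>
  obtain \<psi>A :: "('g \<times> 'x \<Rightarrow> 'r) \<Rightarrow> ('g \<Rightarrow> 'x \<Rightarrow> 'r)" where \<psi>A: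
    "algebra_iso (steinberg_algebra A.\<G>) (skew_ring G X D \<theta>) \<psi>A" "\<psi>A ` steinberg_diagonal A.\<G> = Lc_in_skew G X"
    by (rule A.skew_ring_iso_inverse)
  obtain \<psi>B :: "('h \<times> 'y \<Rightarrow> 'r) \<Rightarrow> ('h \<Rightarrow> 'y \<Rightarrow> 'r)" where \<psi>B:
    "algebra_iso (steinberg_algebra B.\<G>) (skew_ring H Y E \<gamma>) \<psi>B" "\<psi>B ` steinberg_diagonal B.\<G> = Lc_in_skew H Y"
    by (rule B.skew_ring_iso_inverse)
  have ii_iii: "\<exists>\<Phi> :: ('g \<Rightarrow> 'x \<Rightarrow> 'r) \<Rightarrow> ('h \<Rightarrow> 'y \<Rightarrow> 'r).
      algebra_iso (skew_ring G X D \<theta>) (skew_ring H Y E \<gamma>) \<Phi> \<and> \<Phi> ` Lc_in_skew G X = Lc_in_skew H Y"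
    if "diagonal_preserving_iso A.\<G> B.\<G> \<Gamma>" for \<Gamma> :: "('g \<times> 'x \<Rightarrow> 'r) \<Rightarrow> ('h \<times> 'y \<Rightarrow> 'r)"
  proof (intro exI conjI)
    show "algebra_iso (skew_ring G X D \<theta>) (skew_ring H Y E \<gamma>) (\<lambda>F. \<psi>B (\<Gamma> (case_prod F)))"
      using that algebra_iso_comp[OF algebra_iso_comp[OF A.skew_ring_iso] \<psi>B(1)]
      by (simp add: diagonal_preserving_iso_def)
    have "(\<lambda>F. \<psi>B (\<Gamma> (case_prod F))) ` Lc_in_skew G X = \<psi>B ` \<Gamma> ` case_prod ` Lc_in_skew G X"
      by (simp add: image_image)
    then show "(\<lambda>F. \<psi>B (\<Gamma> (case_prod F))) ` Lc_in_skew G X = Lc_in_skew H Y"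
      using that \<psi>B(2) by (simp add: A.case_prod_Lc_in_skew diagonal_preserving_iso_def)
  qed
  have iii_ii: "\<exists>\<Gamma> :: ('g \<times> 'x \<Rightarrow> 'r) \<Rightarrow> ('h \<times> 'y \<Rightarrow> 'r). diagonal_preserving_iso A.\<G> B.\<G> \<Gamma>"
    if \<Phi>: "algebra_iso (skew_ring G X D \<theta>) (skew_ring H Y E \<gamma>) \<Phi>" "\<Phi> ` Lc_in_skew G X = Lc_in_skew H Y"
    for \<Phi> :: "('g \<Rightarrow> 'x \<Rightarrow> 'r) \<Rightarrow> ('h \<Rightarrow> 'y \<Rightarrow> 'r)"
  proof
    have "(\<lambda>f. case_prod (\<Phi> (\<psi>A f))) ` steinberg_diagonal A.\<G> = case_prod ` \<Phi> ` \<psi>A ` steinberg_diagonal A.\<G>"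
      by (simp add: image_image)
    then show "diagonal_preserving_iso A.\<G> B.\<G> (\<lambda>f. case_prod (\<Phi> (\<psi>A f)))"
      using algebra_iso_comp[OF algebra_iso_comp[OF \<psi>A(1) \<Phi>(1)] B.skew_ring_iso] \<psi>A(2) \<Phi>(2)
      by (simp add: diagonal_preserving_iso_def B.case_prod_Lc_in_skew)
  qed
  show ?thesis
    using i_ii ii_i ii_iii iii_ii by blast
qed

end
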